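(* Let $G$ be a finite group, let $m=p$ be prime, let $\underline{R}$ be a $G\times\Sigma_p$-Green functor, and let $L\le G$. Then the ideal $\underline{J}(G/L)\subseteq\underline{R}\uparrow(G/L)$ is generated by $\underline{I}_{\mathrm{Tr}}(G/L)$ and the images of the transfers $$\underline{R}\big((G\times\Sigma_p)/\Gamma(a)\big)\xrightarrow{\ \mathrm{Tr}\ }\underline{R}(G/L)=\underline{R}\uparrow(G/L)$$ for all subgroups $S\le L$ and all homomorphisms $a:S\to\Sigma_p$ whose image contains a $p$-cycle.
   Context: For a finite group $\Gamma$, a $\Gamma$-Green functor is a $\Gamma$-Mackey functor (extended additively to all finite $\Gamma$-sets) that is levelwise a commutative ring, with restrictions ring maps and each transfer $\underline{R}(A)\to\underline{R}(B)$ a map of $\underline{R}(B)$-modules. For a $G\times\Sigma_m$-Green functor $\underline{R}$, the induced $G$-Green functor is $\underline{R}\uparrow(A)=\underline{R}(A)$, where the $G$-set $A$ is given trivial $\Sigma_m$-action. $\underline{I}_{\mathrm{Tr}}(G/L)\subseteq\underline{R}\uparrow(G/L)$ is the ideal that is the image of the transfers $\bigoplus_{i+j=m,\,i,j>0}\underline{R}((G\times\Sigma_m)/(L\times\Sigma_i\times\Sigma_j))\to\underline{R}((G\times\Sigma_m)/(L\times\Sigma_m))$. $\underline{J}(G/L)\subseteq\underline{R}\uparrow(G/L)$ is the ideal generated by $\underline{I}_{\mathrm{Tr}}(G/L)$ and the images of the transfers along $Z^{L,H}\hookrightarrow(G/H)^{\times_{G/L}m}\to G/L$ for all $H\le L$,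 where $(G/H)^{\times_{G/L}m}$ is the $m$-fold fibre product over $G/L$ ($G$ acting diagonally, $\Sigma_m$ permuting factors) and $Z^{L,H}$ is the complement of its diagonal $\Delta(G/H)$. $\Gamma(a)=\{(s,a(s))\mid s\in S\}\le G\times\Sigma_p$ is the graph of $a$; the transfer is along the map of $G\times\Sigma_p$-sets $(G\times\Sigma_p)/\Gamma(a)\to G/L$, $(g,\sigma)\Gamma(a)\mapsto gL$. *)

theory Defs
  imports "HOL-Algebra.Algebra" "HOL-Algebra.Left_Coset" "HOL-Computational_Algebra.Primes"
begin

section \<open>Finite group actions\<close>

record ('a, 'u) gset =
  pts :: "'u set"
  act :: "'a \<Rightarrow> 'u \<Rightarrow> 'u"

definition finite_gset :: "('a, 'b) monoid_scheme \<Rightarrow> ('a, 'u) gset \<Rightarrow> bool" where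
  "finite_gset \<Gamma> A \<longleftrightarrow> finite (pts A) \<and> group_action \<Gamma> (pts A) (act A)"

definition gmap ::
    "('a, 'b) monoid_scheme \<Rightarrow> ('a, 'u) gset \<Rightarrow> ('a, 'u) gset \<Rightarrow> ('u \<Rightarrow> 'u) \<Rightarrow> bool" where
  "gmap \<Gamma> A B f \<longleftrightarrow> finite_gset \<Gamma> A \<and> finite_gset \<Gamma> B \<and> f \<in> pts A \<rightarrow> pts B \<and>
     (\<forall>g\<in>carrier \<Gamma>. \<forall>x\<in>pts A. f (act A g x) = act B g (f x))"

definition gset_coproduct ::
    "('a, 'b) monoid_scheme \<Rightarrow> ('a, 'u) gset \<Rightarrow> ('a, 'u) gset \<Rightarrow> ('a, 'u) gset
      \<Rightarrow> ('u \<Rightarrow> 'u) \<Rightarrow> ('u \<Rightarrow> 'u) \<Rightarrow> bool" where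
  "gset_coproduct \<Gamma> A B C i j \<longleftrightarrow> gmap \<Gamma> A C i \<and> gmap \<Gamma> B C j \<and>
     inj_on i (pts A) \<and> inj_on j (pts B) \<and>
     i ` pts A \<inter> j ` pts B = {} \<and> i ` pts A \<union> j ` pts B = pts C"

text \<open>\<^term>\<open>gset_pullback \<Gamma> P A B C p q f g\<close> is a cartesian square with
  \<open>p : P \<rightarrow> A\<close>, \<open>q : P \<rightarrow> B\<close>, \<open>f : A \<rightarrow> C\<close>, \<open>g : B \<rightarrow> C\<close>.\<close>

definition gset_pullback ::
    "('a, 'b) monoid_scheme \<Rightarrow> ('a, 'u) gset \<Rightarrow> ('a, 'u) gset \<Rightarrow> ('a, 'u) gset \<Rightarrow> ('a, 'u) gset
      \<Rightarrow> ('u \<Rightarrow> 'u) \<Rightarrow> ('u \<Rightarrow> 'u) \<Rightarrow> ('u \<Rightarrow> 'u) \<Rightarrow> ('u \<Rightarrow> 'u) \<Rightarrow> bool" where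
  "gset_pullback \<Gamma> P A B C p q f g \<longleftrightarrow>
     gmap \<Gamma> P A p \<and> gmap \<Gamma> P B q \<and> gmap \<Gamma> A C f \<and> gmap \<Gamma> B C g \<and>
     bij_betw (\<lambda>x. (p x, q x)) (pts P) {(a, b). a \<in> pts A \<and> b \<in> pts B \<and> f a = g b}"


section \<open>Mackey and Green functors\<close>

text \<open>A Mackey functor, extended additively to all finite \<open>\<Gamma>\<close>-sets, is a pair of a contravariant
  functor (\<open>res\<close>) and a covariant functor (\<open>tr\<close>) with the same values \<open>M A\<close>, satisfying base change
  along cartesian squares (the double coset formula) and taking coproducts to products.
  For an equivariant \<open>f : A \<rightarrow> B\<close> the maps are \<open>res A B f : M B \<rightarrow> M A\<close> and \<open>tr A B f : M A \<rightarrow> M B\<close>.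
  Only the additive part of the record \<open>M A\<close> plays a role here. The finite \<open>\<Gamma>\<close>-sets are those with
  points in the type \<open>'u\<close>; if \<open>'u\<close> is infinite, this is up to equivalence the category of all
  finite \<open>\<Gamma>\<close>-sets. The two congruence axioms say that \<open>res\<close> and \<open>tr\<close> depend only on the values of
  \<open>f\<close> on the points of \<open>A\<close>, i.e. on the morphism.\<close>

locale mackey_functor =
  fixes \<Gamma> :: "('a, 'b) monoid_scheme"
    and M :: "('a, 'u) gset \<Rightarrow> 'r ring"
    and res tr :: "('a, 'u) gset \<Rightarrow> ('a, 'u) gset \<Rightarrow> ('u \<Rightarrow> 'u) \<Rightarrow> 'r \<Rightarrow> 'r"
  assumes infinite_points: "infinite (UNIV :: 'u set)"
    and group: "group \<Gamma>"
    and finite_group: "finite (carrier \<Gamma>)"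
    and abelian_group: "finite_gset \<Gamma> A \<Longrightarrow> abelian_group (M A)"
    and res_hom: "gmap \<Gamma> A B f \<Longrightarrow> abelian_group_hom (M B) (M A) (res A B f)"
    and tr_hom: "gmap \<Gamma> A B f \<Longrightarrow> abelian_group_hom (M A) (M B) (tr A B f)"
    and res_cong: "\<lbrakk>gmap \<Gamma> A B f; \<And>a. a \<in> pts A \<Longrightarrow> f a = f' a; y \<in> carrier (M B)\<rbrakk>
      \<Longrightarrow> res A B f y = res A B f' y"
    and tr_cong: "\<lbrakk>gmap \<Gamma> A B f; \<And>a. a \<in> pts A \<Longrightarrow> f a = f' a; x \<in> carrier (M A)\<rbrakk>
      \<Longrightarrow> tr A B f x = tr A B f' x"
    and res_id: "\<lbrakk>finite_gset \<Gamma> A; x \<in> carrier (M A)\<rbrakk> \<Longrightarrow> res A A (\<lambda>a. a) x = x"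
    and tr_id: "\<lbrakk>finite_gset \<Gamma> A; x \<in> carrier (M A)\<rbrakk> \<Longrightarrow> tr A A (\<lambda>a. a) x = x"
    and res_comp: "\<lbrakk>gmap \<Gamma> A B f; gmap \<Gamma> B C g; z \<in> carrier (M C)\<rbrakk>
      \<Longrightarrow> res A C (\<lambda>a. g (f a)) z = res A B f (res B C g z)"
    and tr_comp: "\<lbrakk>gmap \<Gamma> A B f; gmap \<Gamma> B C g; x \<in> carrier (M A)\<rbrakk>
      \<Longrightarrow> tr A C (\<lambda>a. g (f a)) x = tr B C g (tr A B f x)"
    and base_change: "\<lbrakk>gset_pullback \<Gamma> P A B C p q f g; x \<in> carrier (M A)\<rbrakk>
      \<Longrightarrow> res B C g (tr A C f x) = tr P B q (res P A p x)"
    and empty: "\<lbrakk>finite_gset \<Gamma> A; pts A = {}\<rbrakk> \<Longrightarrow> carrier (M A) = {\<zero>\<^bsub>M A\<^esub>}"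
    and additive: "gset_coproduct \<Gamma> A B C i j
      \<Longrightarrow> bij_betw (\<lambda>z. (res A C i z, res B C j z)) (carrier (M C)) (carrier (M A) \<times> carrier (M B))"

locale green_functor = mackey_functor \<Gamma> R res tr
  for \<Gamma> :: "('a, 'b) monoid_scheme"
    and R :: "('a, 'u) gset \<Rightarrow> 'r ring"
    and res tr :: "('a, 'u) gset \<Rightarrow> ('a, 'u) gset \<Rightarrow> ('u \<Rightarrow> 'u) \<Rightarrow> 'r \<Rightarrow> 'r" +
  assumes cring: "finite_gset \<Gamma> A \<Longrightarrow> cring (R A)"
    and res_ring_hom: "gmap \<Gamma> A B f \<Longrightarrow> res A B f \<in> ring_hom (R B) (R A)"
    and tr_module_map: "\<lbrakk>gmap \<Gamma> A B f; x \<in> carrier (R A); y \<in> carrier (R B)\<rbrakk>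
      \<Longrightarrow> tr A B f (res A B f y \<otimes>\<^bsub>R A\<^esub> x) = y \<otimes>\<^bsub>R B\<^esub> tr A B f x"


section \<open>The \<open>G\<close>- and \<open>G \<times> \<Sigma>\<^sub>m\<close>-sets involved\<close>

text \<open>One type of points that is large enough for the cosets of \<open>G\<close>, the cosets of
  \<open>G \<times> \<Sigma>\<^sub>m\<close>, and tuples of cosets of \<open>G\<close>.\<close>

datatype 'g point =
    Coset (un_Coset: "'g set")
  | ProdCoset (un_ProdCoset: "('g \<times> (nat \<Rightarrow> nat)) set")
  | Tuple (un_Tuple: "nat \<Rightarrow> 'g set")

lemma infinite_point: "infinite (UNIV :: 'g point set)"
proof
  let ?f = "\<lambda>n::nat. Tuple (\<lambda>k. if k = n then UNIV else {}) :: 'g point"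
  assume "finite (UNIV :: 'g point set)"
  moreover have "inj ?f"
    by (auto simp: inj_def fun_eq_iff split: if_splits)
  ultimately have "finite (UNIV :: nat set)"
    by (rule finite_imageD[OF finite_subset[OF subset_UNIV]])
  then show False by simp
qed

definition coset_gset :: "('g, 'b) monoid_scheme \<Rightarrow> 'g set \<Rightarrow> ('g, 'g point) gset" where
  "coset_gset G L =
     \<lparr>pts = Coset ` (lcosets\<^bsub>G\<^esub> L),
      act = \<lambda>g. \<lambda>x\<in>Coset ` (lcosets\<^bsub>G\<^esub> L). Coset (g <#\<^bsub>G\<^esub> un_Coset x)\<rparr>"

abbreviation G_Sigma :: "('g, 'b) monoid_scheme \<Rightarrow> nat \<Rightarrow> ('g \<times> (nat \<Rightarrow> nat)) monoid" where
  "G_Sigma G m \<equiv> G \<times>\<times> sym_group m"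

definition prod_coset_gset ::
    "('g, 'b) monoid_scheme \<Rightarrow> nat \<Rightarrow> ('g \<times> (nat \<Rightarrow> nat)) set
      \<Rightarrow> ('g \<times> (nat \<Rightarrow> nat), 'g point) gset" where
  "prod_coset_gset G m K =
     \<lparr>pts = ProdCoset ` (lcosets\<^bsub>G_Sigma G m\<^esub> K),
      act = \<lambda>\<gamma>. \<lambda>x\<in>ProdCoset ` (lcosets\<^bsub>G_Sigma G m\<^esub> K).
              ProdCoset (\<gamma> <#\<^bsub>G_Sigma G m\<^esub> un_ProdCoset x)\<rparr>"

definition trivial_Sigma :: "('g, 'u) gset \<Rightarrow> ('g \<times> (nat \<Rightarrow> nat), 'u) gset" where
  "trivial_Sigma A = \<lparr>pts = pts A, act = \<lambda>(g, \<sigma>). act A g\<rparr>"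

definition induced_green ::
    "(('g \<times> (nat \<Rightarrow> nat), 'u) gset \<Rightarrow> 'r ring) \<Rightarrow> ('g, 'u) gset \<Rightarrow> 'r ring" where
  "induced_green R A = R (trivial_Sigma A)"

text \<open>For \<open>H \<le> L\<close> the projection \<open>G/H \<rightarrow> G/L\<close>, \<open>gH \<mapsto> gL\<close>, sends a coset \<open>C\<close> to the product of
  subsets \<open>C L\<close>. For a subgroup \<open>K\<close> of \<open>G \<times> \<Sigma>\<^sub>m\<close> whose first projection lies in \<open>L\<close>, the map
  \<open>(g, \<sigma>)K \<mapsto> gL\<close> sends a coset \<open>C\<close> to \<open>fst(C) L\<close>.\<close>

definition coset_proj :: "('g, 'b) monoid_scheme \<Rightarrow> 'g set \<Rightarrow> 'g point \<Rightarrow> 'g point" where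
  "coset_proj G L x = Coset (fst ` un_ProdCoset x <#>\<^bsub>G\<^esub> L)"

text \<open>The \<open>m\<close>-fold fibre product of \<open>G/H\<close> over \<open>G/L\<close> (for \<open>m > 0\<close>), its diagonal, the complement
  of the diagonal, and the structure map to \<open>G/L\<close>, which may be read off from the first factor.\<close>

definition fibre_power_pts ::
    "('g, 'b) monoid_scheme \<Rightarrow> nat \<Rightarrow> 'g set \<Rightarrow> 'g set \<Rightarrow> 'g point set" where
  "fibre_power_pts G m L H =
     Tuple ` {x \<in> {1..m} \<rightarrow>\<^sub>E lcosets\<^bsub>G\<^esub> H.
        \<forall>i\<in>{1..m}. \<forall>j\<in>{1..m}. x i <#>\<^bsub>G\<^esub> L = x j <#>\<^bsub>G\<^esub> L}"

definition diagonal_pts :: "('g, 'b) monoid_scheme \<Rightarrow> nat \<Rightarrow> 'g set \<Rightarrow> 'g point set" where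
  "diagonal_pts G m H = (\<lambda>C. Tuple (\<lambda>i\<in>{1..m}. C)) ` (lcosets\<^bsub>G\<^esub> H)"

definition Z_gset ::
    "('g, 'b) monoid_scheme \<Rightarrow> nat \<Rightarrow> 'g set \<Rightarrow> 'g set
      \<Rightarrow> ('g \<times> (nat \<Rightarrow> nat), 'g point) gset" where
  "Z_gset G m L H =
     \<lparr>pts = fibre_power_pts G m L H - diagonal_pts G m H,
      act = \<lambda>(g, \<sigma>). \<lambda>x\<in>fibre_power_pts G m L H - diagonal_pts G m H.
        Tuple (\<lambda>i\<in>{1..m}. g <#\<^bsub>G\<^esub> un_Tuple x ((inv\<^bsub>sym_group m\<^esub> \<sigma>) i))\<rparr>"

definition Z_proj :: "('g, 'b) monoid_scheme \<Rightarrow> 'g set \<Rightarrow> 'g point \<Rightarrow> 'g point" where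
  "Z_proj G L x = Coset (un_Tuple x 1 <#>\<^bsub>G\<^esub> L)"


section \<open>The ideals\<close>

text \<open>The subgroup \<open>\<Sigma>\<^sub>i \<times> \<Sigma>\<^sub>j\<close> of \<open>\<Sigma>\<^sub>i\<^sub>+\<^sub>j\<close>.\<close>

definition young_subgroup :: "nat \<Rightarrow> nat \<Rightarrow> (nat \<Rightarrow> nat) set" where
  "young_subgroup i j = {\<sigma> \<circ> \<tau> | \<sigma> \<tau>. \<sigma> permutes {1..i} \<and> \<tau> permutes {i + 1..i + j}}"

definition graph_subgroup :: "'g set \<Rightarrow> ('g \<Rightarrow> nat \<Rightarrow> nat) \<Rightarrow> ('g \<times> (nat \<Rightarrow> nat)) set" where
  "graph_subgroup S a = {(s, a s) | s. s \<in> S}"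

text \<open>The image of the transfer along \<open>(G \<times> \<Sigma>\<^sub>m)/K \<rightarrow> G/L\<close> is taken in the value at \<open>G/L\<close> with
  trivial \<open>\<Sigma>\<^sub>m\<close>-action, which for \<open>K = L \<times> \<Sigma>\<^sub>i \<times> \<Sigma>\<^sub>j\<close> is identified with
  \<open>(G \<times> \<Sigma>\<^sub>m)/(L \<times> \<Sigma>\<^sub>m)\<close>.\<close>

definition I_Tr ::
    "('g, 'b) monoid_scheme \<Rightarrow> nat
      \<Rightarrow> (('g \<times> (nat \<Rightarrow> nat), 'g point) gset \<Rightarrow> 'r ring)
      \<Rightarrow> (('g \<times> (nat \<Rightarrow> nat), 'g point) gset \<Rightarrow> ('g \<times> (nat \<Rightarrow> nat), 'g point) gset
          \<Rightarrow> ('g point \<Rightarrow> 'g point) \<Rightarrow> 'r \<Rightarrow> 'r)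
      \<Rightarrow> 'g set \<Rightarrow> 'r set" where
  "I_Tr G m R tr L =
     {finsum (induced_green R (coset_gset G L))
        (\<lambda>(i, j). tr (prod_coset_gset G m (L \<times> young_subgroup i j))
                     (trivial_Sigma (coset_gset G L)) (coset_proj G L) (x (i, j)))
        {(i, j). i + j = m \<and> 0 < i \<and> 0 < j}
      | x. \<forall>i j. i + j = m \<and> 0 < i \<and> 0 < j \<longrightarrow>
             x (i, j) \<in> carrier (R (prod_coset_gset G m (L \<times> young_subgroup i j)))}"

definition J_ideal ::
    "('g, 'b) monoid_scheme \<Rightarrow> nat
      \<Rightarrow> (('g \<times> (nat \<Rightarrow> nat), 'g point) gset \<Rightarrow> 'r ring)
      \<Rightarrow> (('g \<times> (nat \<Rightarrow> nat), 'g point) gset \<Rightarrow> ('g \<times> (nat \<Rightarrow> nat), 'g point) gset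
          \<Rightarrow> ('g point \<Rightarrow> 'g point) \<Rightarrow> 'r \<Rightarrow> 'r)
      \<Rightarrow> 'g set \<Rightarrow> 'r set" where
  "J_ideal G m R tr L =
     Idl\<^bsub>induced_green R (coset_gset G L)\<^esub>
       (I_Tr G m R tr L \<union>
        (\<Union>H\<in>{H. subgroup H G \<and> H \<subseteq> L}.
           tr (Z_gset G m L H) (trivial_Sigma (coset_gset G L)) (Z_proj G L)
             ` carrier (R (Z_gset G m L H))))"

definition contains_long_cycle :: "nat \<Rightarrow> (nat \<Rightarrow> nat) set \<Rightarrow> bool" where
  "contains_long_cycle m T \<longleftrightarrow>
     (\<exists>cs. cycle cs \<and> set cs = {1..m} \<and> cycle_of_list cs \<in> T)"

end

theory Submission
  imports Defs
begin

text \<open>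
  Write \<open>\<Gamma> = G \<times> \<Sigma>\<^sub>p\<close>. By additivity and base change the image of the transfer from a finite \<open>\<Gamma>\<close>-set is
  controlled by its orbits, and a transfer from an orbit factors through every \<open>\<Gamma>\<close>-set over the
  target that has a suitable point with a larger stabilizer. Every orbit in \<open>Z\<^sup>L\<^sup>,\<^sup>H\<close> contains a tuple
  \<open>x\<close> lying over the base coset \<open>L\<close>; let \<open>K\<close> be its stabilizer.
  If the image of \<open>K\<close> in \<open>\<Sigma>\<^sub>p\<close> is not transitive, then up to a translation by \<open>\<Sigma>\<^sub>p\<close> it lies in some
  \<open>\<Sigma>\<^sub>i \<times> \<Sigma>\<^sub>j\<close> and the transfer lands in \<open>I\<^sub>T\<^sub>r\<close>. If it is transitive, the fibres of \<open>i \<mapsto> x\<^sub>i\<close> all have the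
  same size, a proper divisor of the prime \<open>p\<close>, so the entries of \<open>x\<close> are distinct and \<open>K\<close> is the
  graph of a homomorphism, whose transitive image contains a \<open>p\<close>-cycle by Sylow's theorem.
  Conversely, if the image of \<open>a : S \<rightarrow> \<Sigma>\<^sub>p\<close> contains a \<open>p\<close>-cycle, let \<open>H\<close> be the stabilizer of \<open>1\<close> in
  \<open>S\<close> and choose \<open>s\<^sub>i \<in> S\<close> with \<open>a(s\<^sub>i)(1) = i\<close>; the tuple \<open>(s\<^sub>i H)\<^sub>i\<close> is a point of \<open>Z\<^sup>L\<^sup>,\<^sup>H\<close> fixed by
  the graph of \<open>a\<close>.
\<close>

section \<open>Orbits and transfers\<close>

text \<open>The inverse of \<open>act A g\<close> is the action of the inverse element, so
  bijectivity follows from the pointwise laws. Extensionality has to be asked for because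
  \<open>BijGroup\<close> consists of extensional maps and the homomorphism law is an equality of
  functions.\<close>

lemma finite_gsetI:
  assumes "group \<Gamma>" "finite (pts A)"
    and ext: "\<And>g. g \<in> carrier \<Gamma> \<Longrightarrow> act A g \<in> extensional (pts A)"
    and closed: "\<And>g x. \<lbrakk>g \<in> carrier \<Gamma>; x \<in> pts A\<rbrakk> \<Longrightarrow> act A g x \<in> pts A"
    and one: "\<And>x. x \<in> pts A \<Longrightarrow> act A \<one>\<^bsub>\<Gamma>\<^esub> x = x"
    and mult: "\<And>g h x. \<lbrakk>g \<in> carrier \<Gamma>; h \<in> carrier \<Gamma>; x \<in> pts A\<rbrakk>
      \<Longrightarrow> act A (g \<otimes>\<^bsub>\<Gamma>\<^esub> h) x = act A g (act A h x)"
  shows "finite_gset \<Gamma> A"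
proof -
  interpret group \<Gamma> by fact
  have bij: "act A g \<in> Bij (pts A)" if g: "g \<in> carrier \<Gamma>" for g
  proof -
    have "bij_betw (act A g) (pts A) (pts A)"
      by (rule bij_betw_byWitness[where f' = "act A (inv\<^bsub>\<Gamma>\<^esub> g)"])
        (use g closed one mult[of g "inv\<^bsub>\<Gamma>\<^esub> g"] mult[of "inv\<^bsub>\<Gamma>\<^esub> g" g] in auto)
    with ext g show ?thesis by (simp add: Bij_def)
  qed
  have "act A (g \<otimes>\<^bsub>\<Gamma>\<^esub> h) = compose (pts A) (act A g) (act A h)"
    if "g \<in> carrier \<Gamma>" "h \<in> carrier \<Gamma>" for g h
    by (rule extensionalityI[of _ "pts A"])
      (use that ext mult in \<open>auto simp: compose_def\<close>)
  with bij have "act A \<in> hom \<Gamma> (BijGroup (pts A))"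
    by (auto simp: hom_def BijGroup_def)
  with assms(2) show ?thesis
    by (auto simp: finite_gset_def group_action_def group_hom_def group_hom_axioms_def
        group_BijGroup group_axioms)
qed

lemma
  assumes "finite_gset \<Gamma> A"
  shows act_one: "x \<in> pts A \<Longrightarrow> act A \<one>\<^bsub>\<Gamma>\<^esub> x = x"
    and act_mult: "\<lbrakk>g \<in> carrier \<Gamma>; h \<in> carrier \<Gamma>; x \<in> pts A\<rbrakk>
      \<Longrightarrow> act A (g \<otimes>\<^bsub>\<Gamma>\<^esub> h) x = act A g (act A h x)"
    and act_closed: "\<lbrakk>g \<in> carrier \<Gamma>; x \<in> pts A\<rbrakk> \<Longrightarrow> act A g x \<in> pts A"
    and act_inv: "\<lbrakk>g \<in> carrier \<Gamma>; x \<in> pts A\<rbrakk> \<Longrightarrow> act A (inv\<^bsub>\<Gamma>\<^esub> g) (act A g x) = x"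
proof -
  interpret group_action \<Gamma> "pts A" "act A"
    using assms by (simp add: finite_gset_def)
  show "x \<in> pts A \<Longrightarrow> act A \<one>\<^bsub>\<Gamma>\<^esub> x = x"
    by (metis id_eq_one restrict_apply')
  show "\<lbrakk>g \<in> carrier \<Gamma>; h \<in> carrier \<Gamma>; x \<in> pts A\<rbrakk>
      \<Longrightarrow> act A (g \<otimes>\<^bsub>\<Gamma>\<^esub> h) x = act A g (act A h x)"
    by (rule composition_rule)
  show "\<lbrakk>g \<in> carrier \<Gamma>; x \<in> pts A\<rbrakk> \<Longrightarrow> act A g x \<in> pts A"
    by (rule element_image) auto
  show "\<lbrakk>g \<in> carrier \<Gamma>; x \<in> pts A\<rbrakk> \<Longrightarrow> act A (inv\<^bsub>\<Gamma>\<^esub> g) (act A g x) = x"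
    by (rule orbit_sym_aux) auto
qed

lemma finite_gset_group: "finite_gset \<Gamma> A \<Longrightarrow> group \<Gamma>"
  by (auto simp: finite_gset_def group_action_def group_hom_def)

section \<open>Invariant subsets, orbits and maps out of orbits\<close>

text \<open>The action is cut off outside \<open>U\<close> so that each group element acts by an
  extensional map on \<open>U\<close>.\<close>

definition sub_gset :: "('a, 'u) gset \<Rightarrow> 'u set \<Rightarrow> ('a, 'u) gset" where
  "sub_gset A U = \<lparr>pts = U, act = \<lambda>g. \<lambda>x\<in>U. act A g x\<rparr>"

definition invariant_subset :: "('a, 'b) monoid_scheme \<Rightarrow> ('a, 'u) gset \<Rightarrow> 'u set \<Rightarrow> bool" where
  "invariant_subset \<Gamma> A U \<longleftrightarrow> U \<subseteq> pts A \<and> (\<forall>g\<in>carrier \<Gamma>. \<forall>x\<in>U. act A g x \<in> U)"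

lemma pts_sub_gset [simp]: "pts (sub_gset A U) = U"
  by (simp add: sub_gset_def)

lemma act_sub_gset [simp]: "x \<in> U \<Longrightarrow> act (sub_gset A U) g x = act A g x"
  by (simp add: sub_gset_def)

lemma finite_sub_gset:
  assumes "finite_gset \<Gamma> A" "invariant_subset \<Gamma> A U"
  shows "finite_gset \<Gamma> (sub_gset A U)"
proof (rule finite_gsetI)
  show "group \<Gamma>" using assms(1) by (rule finite_gset_group)
  show "finite (pts (sub_gset A U))"
    using assms by (auto simp: finite_gset_def invariant_subset_def intro: finite_subset)
  show "act (sub_gset A U) g \<in> extensional (pts (sub_gset A U))" for g
    by (simp add: sub_gset_def)
qed (use assms act_one[OF assms(1)] act_mult[OF assms(1)] in
      \<open>auto simp: sub_gset_def invariant_subset_def subset_iff\<close>)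

lemma gmap_sub_gset:
  assumes "gmap \<Gamma> A B f" "invariant_subset \<Gamma> A U"
  shows "gmap \<Gamma> (sub_gset A U) B f"
  using assms finite_sub_gset[of \<Gamma> A U]
  by (auto simp: gmap_def invariant_subset_def subset_iff Pi_iff)

lemma gmap_sub_sub:
  assumes "finite_gset \<Gamma> A" "invariant_subset \<Gamma> A U" "invariant_subset \<Gamma> A V" "U \<subseteq> V"
  shows "gmap \<Gamma> (sub_gset A U) (sub_gset A V) (\<lambda>x. x)"
  using assms finite_sub_gset[of \<Gamma> A U] finite_sub_gset[of \<Gamma> A V]
  by (auto simp: gmap_def subset_iff)

lemma orbit_subset_pts:
  "\<lbrakk>finite_gset \<Gamma> A; x \<in> pts A\<rbrakk> \<Longrightarrow> orbit \<Gamma> (act A) x \<subseteq> pts A"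
  by (auto simp: orbit_def act_closed)

lemma orbit_self: "\<lbrakk>finite_gset \<Gamma> A; x \<in> pts A\<rbrakk> \<Longrightarrow> x \<in> orbit \<Gamma> (act A) x"
  by (auto simp: finite_gset_def intro: group_action.orbit_refl)

lemma orbit_eq:
  assumes "finite_gset \<Gamma> A" "x \<in> pts A" "y \<in> orbit \<Gamma> (act A) x"
  shows "orbit \<Gamma> (act A) y = orbit \<Gamma> (act A) x"
proof -
  interpret group_action \<Gamma> "pts A" "act A"
    using assms(1) by (simp add: finite_gset_def)
  have "y \<in> pts A"
    using orbit_subset_pts[OF assms(1,2)] assms(3) by blast
  with assms show ?thesis
    by (meson orbit_subset_pts orbit_sym orbit_trans subset_antisym subset_iff)
qed

lemma invariant_orbit:
  assumes "finite_gset \<Gamma> A" "x \<in> pts A"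
  shows "invariant_subset \<Gamma> A (orbit \<Gamma> (act A) x)"
proof -
  interpret group \<Gamma> using assms(1) by (rule finite_gset_group)
  show ?thesis
    using orbit_subset_pts[OF assms] act_mult[OF assms(1) _ _ assms(2), symmetric]
    by (fastforce simp: invariant_subset_def orbit_def)
qed

text \<open>If \<open>act A g x\<close> lay in \<open>V\<close>, applying the inverse of
  \<open>g\<close> would put \<open>x\<close> into \<open>V\<close>.\<close>

lemma invariant_Diff:
  assumes "finite_gset \<Gamma> A" "invariant_subset \<Gamma> A U" "invariant_subset \<Gamma> A V"
  shows "invariant_subset \<Gamma> A (U - V)"
proof -
  interpret group \<Gamma> using assms(1) by (rule finite_gset_group)
  have "x \<in> V" if "g \<in> carrier \<Gamma>" "x \<in> U" "act A g x \<in> V" for g x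
    using that assms act_inv[OF assms(1) that(1)] inv_closed[OF that(1)]
    unfolding invariant_subset_def by (metis subsetD)
  with assms show ?thesis
    unfolding invariant_subset_def by blast
qed

text \<open>The map sends the translate of \<open>x\<close> by \<open>g\<close> to the translate of
  \<open>y\<close> by \<open>g\<close>. This is well defined because two elements with the same
  effect on \<open>x\<close> differ by a stabilizing element of \<open>x\<close>, which also fixes
  \<open>y\<close>.\<close>

lemma ex_gmap_from_orbit:
  assumes A: "finite_gset \<Gamma> A" "x \<in> pts A" "pts A = orbit \<Gamma> (act A) x"
    and B: "finite_gset \<Gamma> B" "y \<in> pts B"
    and stab: "stabilizer \<Gamma> (act A) x \<subseteq> stabilizer \<Gamma> (act B) y"
  obtains f where "gmap \<Gamma> A B f" "f x = y"
proof -
  interpret group \<Gamma> using A(1) by (rule finite_gset_group)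
  have wd: "act B g y = act B h y"
    if gh: "g \<in> carrier \<Gamma>" "h \<in> carrier \<Gamma>" and eq: "act A g x = act A h x" for g h
  proof -
    have "act A (inv\<^bsub>\<Gamma>\<^esub> h \<otimes>\<^bsub>\<Gamma>\<^esub> g) x = x"
      using gh eq A(2) by (simp add: act_mult[OF A(1)] act_inv[OF A(1)])
    then have "inv\<^bsub>\<Gamma>\<^esub> h \<otimes>\<^bsub>\<Gamma>\<^esub> g \<in> stabilizer \<Gamma> (act A) x"
      using gh by (simp add: stabilizer_def)
    with stab have fix_y: "act B (inv\<^bsub>\<Gamma>\<^esub> h \<otimes>\<^bsub>\<Gamma>\<^esub> g) y = y"
      by (auto simp: stabilizer_def)
    have "act B g y = act B (h \<otimes>\<^bsub>\<Gamma>\<^esub> (inv\<^bsub>\<Gamma>\<^esub> h \<otimes>\<^bsub>\<Gamma>\<^esub> g)) y"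
      using gh by (simp add: m_assoc[symmetric])
    also have "\<dots> = act B h y"
      using gh B(2) fix_y by (simp add: act_mult[OF B(1)] del: r_inv l_inv)
    finally show ?thesis .
  qed
  \<comment> \<open>The element carrying \<open>x\<close> to \<open>z\<close> is an arbitrary
    choice; \<open>wd\<close> makes the value independent of it.\<close>
  define f where "f z = act B (SOME g. g \<in> carrier \<Gamma> \<and> act A g x = z) y" for z
  have f: "f (act A g x) = act B g y" if "g \<in> carrier \<Gamma>" for g
  proof -
    have "(SOME h. h \<in> carrier \<Gamma> \<and> act A h x = act A g x) \<in> carrier \<Gamma> \<and>
      act A (SOME h. h \<in> carrier \<Gamma> \<and> act A h x = act A g x) x = act A g x"
      by (rule someI[where x = g]) (use that in simp)
    then show ?thesis
      unfolding f_def using that by (intro wd) auto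
  qed
  have "f \<in> pts A \<rightarrow> pts B"
    unfolding A(3) orbit_def using f act_closed[OF B(1) _ B(2)] by auto
  moreover have "f (act A g z) = act B g (f z)" if "g \<in> carrier \<Gamma>" "z \<in> pts A" for g z
  proof -
    from that A(3) obtain h where h: "h \<in> carrier \<Gamma>" "z = act A h x"
      by (auto simp: orbit_def)
    with that have "f (act A g z) = f (act A (g \<otimes>\<^bsub>\<Gamma>\<^esub> h) x)"
      using A(2) by (simp add: act_mult[OF A(1)])
    also have "\<dots> = act B g (f z)"
      using that h B(2) by (simp add: f act_mult[OF B(1)])
    finally show ?thesis .
  qed
  ultimately have "gmap \<Gamma> A B f"
    using A(1) B(1) by (simp add: gmap_def)
  moreover have "f x = y"
    using f[OF one_closed] act_one[OF A(1,2)] act_one[OF B] by simp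
  ultimately show ?thesis using that by blast
qed

lemma gmap_from_orbit_unique:
  assumes "gmap \<Gamma> A C f" "gmap \<Gamma> A C h" "pts A = orbit \<Gamma> (act A) x" "x \<in> pts A" "f x = h x"
    and "z \<in> pts A"
  shows "f z = h z"
proof -
  obtain g where "g \<in> carrier \<Gamma>" "z = act A g x"
    using assms(3,6) by (auto simp: orbit_def)
  with assms(1,2,4,5) show ?thesis
    by (simp add: gmap_def)
qed

section \<open>Transfers in a Mackey functor, orbit by orbit\<close>

context mackey_functor
begin

lemma tr_closed: "\<lbrakk>gmap \<Gamma> A B f; x \<in> carrier (M A)\<rbrakk> \<Longrightarrow> tr A B f x \<in> carrier (M B)"
  using tr_hom[of A B f] by (simp add: abelian_group_hom.hom_closed)

lemma res_closed: "\<lbrakk>gmap \<Gamma> A B f; y \<in> carrier (M B)\<rbrakk> \<Longrightarrow> res A B f y \<in> carrier (M A)"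
  using res_hom[of A B f] by (simp add: abelian_group_hom.hom_closed)

text \<open>For injective \<open>i\<close> the fibre product of \<open>A\<close> with itself over
  \<open>C\<close> is the diagonal, so base change applies to the square whose sides out of the
  corner are identities.\<close>

lemma res_tr_inj:
  assumes "gmap \<Gamma> A C i" "inj_on i (pts A)" "x \<in> carrier (M A)"
  shows "res A C i (tr A C i x) = x"
proof -
  have "finite_gset \<Gamma> A" using assms(1) by (simp add: gmap_def)
  moreover have "gset_pullback \<Gamma> A A A C (\<lambda>a. a) (\<lambda>a. a) i i"
    using assms(1,2) by (auto simp: gset_pullback_def gmap_def bij_betw_def inj_on_def)
  ultimately show ?thesis
    using base_change[of A A A C "\<lambda>a. a" "\<lambda>a. a" i i x] assms(3) by (simp add: res_id tr_id)
qed

text \<open>The fibre product of two maps with disjoint images is empty, so base change routes the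
  composite through a zero group.\<close>

lemma res_tr_disjoint:
  assumes A: "gmap \<Gamma> A C i" and B: "gmap \<Gamma> B C j"
    and disj: "i ` pts A \<inter> j ` pts B = {}" and x: "x \<in> carrier (M B)"
  shows "res A C i (tr B C j x) = \<zero>\<^bsub>M A\<^esub>"
proof -
  \<comment> \<open>The empty set with action, realized as an invariant subset of
    \<open>A\<close>.\<close>
  define E where "E = sub_gset A {}"
  have fA: "finite_gset \<Gamma> A" using A by (simp add: gmap_def)
  then have E: "finite_gset \<Gamma> E"
    unfolding E_def by (rule finite_sub_gset) (simp add: invariant_subset_def)
  have EA: "gmap \<Gamma> E A (\<lambda>a. a)" and EB: "gmap \<Gamma> E B (\<lambda>a. a)"
    using A B E by (auto simp: gmap_def E_def)
  have "gset_pullback \<Gamma> E B A C (\<lambda>a. a) (\<lambda>a. a) j i"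
    using EA EB A B disj by (force simp: gset_pullback_def bij_betw_def E_def)
  then have "res A C i (tr B C j x) = tr E A (\<lambda>a. a) (res E B (\<lambda>a. a) x)"
    using x by (rule base_change)
  also have "res E B (\<lambda>a. a) x = \<zero>\<^bsub>M E\<^esub>"
    using res_closed[OF EB x] empty[OF E] by (simp add: E_def)
  also have "tr E A (\<lambda>a. a) \<zero>\<^bsub>M E\<^esub> = \<zero>\<^bsub>M A\<^esub>"
    using tr_hom[OF EA] by (rule abelian_group_hom.hom_zero)
  finally show ?thesis .
qed

text \<open>By \<open>additive\<close> the two restrictions are jointly injective, so it suffices to
  compare restrictions of both sides; the cross terms vanish by
  \<open>res_tr_disjoint\<close>.\<close>

lemma coproduct_decomposition:
  assumes C: "gset_coproduct \<Gamma> A B C i j" and z: "z \<in> carrier (M C)"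
  shows "z = tr A C i (res A C i z) \<oplus>\<^bsub>M C\<^esub> tr B C j (res B C j z)" (is "z = ?w")
proof -
  have i: "gmap \<Gamma> A C i" "inj_on i (pts A)" and j: "gmap \<Gamma> B C j" "inj_on j (pts B)"
    and disj: "i ` pts A \<inter> j ` pts B = {}"
    using C by (auto simp: gset_coproduct_def)
  interpret MC: abelian_group "M C" using i(1) by (simp add: gmap_def abelian_group)
  interpret MA: abelian_group "M A" using i(1) by (simp add: gmap_def abelian_group)
  interpret MB: abelian_group "M B" using j(1) by (simp add: gmap_def abelian_group)
  interpret ri: abelian_group_hom "M C" "M A" "res A C i" using i(1) by (rule res_hom)
  interpret rj: abelian_group_hom "M C" "M B" "res B C j" using j(1) by (rule res_hom)
  have u: "res A C i z \<in> carrier (M A)" and v: "res B C j z \<in> carrier (M B)"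
    using z by simp_all
  have tu: "tr A C i (res A C i z) \<in> carrier (M C)" and tv: "tr B C j (res B C j z) \<in> carrier (M C)"
    using u v i(1) j(1) by (auto intro: tr_closed)
  have "res A C i ?w = res A C i z"
    using tu tv u v res_tr_inj[OF i u] res_tr_disjoint[OF i(1) j(1) disj v] by simp
  moreover have "res B C j ?w = res B C j z"
    using tu tv u v res_tr_inj[OF j v] res_tr_disjoint[OF j(1) i(1) _ u] disj
    by (simp add: Int_commute)
  moreover have "inj_on (\<lambda>z. (res A C i z, res B C j z)) (carrier (M C))"
    using additive[OF C] by (simp add: bij_betw_def)
  moreover have "?w \<in> carrier (M C)" using tu tv by simp
  ultimately show ?thesis
    using z by (metis (no_types, lifting) inj_onD)
qed

text \<open>Splitting off one orbit writes an element as a sum of two transferred elements, and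
  functoriality turns its transfer to \<open>B\<close> into a sum of transfers from smaller sets.
  Closure of \<open>N\<close> under zero and addition is all that the summation uses; in the
  application \<open>N\<close> is an ideal.\<close>

lemma tr_image_subset_orbitwise:
  assumes f: "gmap \<Gamma> A B f"
    and zero: "\<zero>\<^bsub>M B\<^esub> \<in> N" and add: "\<And>u v. \<lbrakk>u \<in> N; v \<in> N\<rbrakk> \<Longrightarrow> u \<oplus>\<^bsub>M B\<^esub> v \<in> N"
    and orbits: "\<And>x. x \<in> pts A \<Longrightarrow> tr (sub_gset A (orbit \<Gamma> (act A) x)) B f
      ` carrier (M (sub_gset A (orbit \<Gamma> (act A) x))) \<subseteq> N"
  shows "tr A B f ` carrier (M A) \<subseteq> N"
proof -
  have A: "finite_gset \<Gamma> A" using f by (simp add: gmap_def)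
  then have fin: "finite (pts A)" by (simp add: finite_gset_def)
  \<comment> \<open>The induction runs over invariant subsets of the fixed set \<open>A\<close>,
    since what remains after removing an orbit is again of this form and its orbits are still orbits
    of \<open>A\<close>.\<close>
  have *: "tr (sub_gset A U) B f ` carrier (M (sub_gset A U)) \<subseteq> N"
    if "invariant_subset \<Gamma> A U" for U
    using that
  proof (induction "card U" arbitrary: U rule: less_induct)
    case less
    let ?U = "sub_gset A U"
    note U = less.prems
    have fX: "gmap \<Gamma> ?U B f" using f U by (rule gmap_sub_gset)
    interpret tX: abelian_group_hom "M ?U" "M B" "tr ?U B f" using fX by (rule tr_hom)
    show ?case
    proof (cases "U = {}")
      case True
      then have "carrier (M ?U) = {\<zero>\<^bsub>M ?U\<^esub>}"
        using finite_sub_gset[OF A U] by (intro empty) auto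
      with zero show ?thesis by simp
    next
      case False
      then obtain x where x: "x \<in> U" by blast
      with U have xA: "x \<in> pts A" by (auto simp: invariant_subset_def)
      define Q where "Q = orbit \<Gamma> (act A) x"
      let ?Q = "sub_gset A Q" and ?V = "sub_gset A (U - Q)"
      have Q: "invariant_subset \<Gamma> A Q"
        unfolding Q_def using A xA by (rule invariant_orbit)
      have QX: "Q \<subseteq> U"
        using U x by (auto simp: Q_def orbit_def invariant_subset_def)
      have V: "invariant_subset \<Gamma> A (U - Q)"
        using A U Q by (rule invariant_Diff)
      have "x \<in> Q" unfolding Q_def using A xA by (rule orbit_self)
      moreover have "finite U" using U fin by (auto simp: invariant_subset_def intro: finite_subset)
      ultimately have "card (U - Q) < card U"
        using x by (metis DiffE Diff_subset psubsetI psubset_card_mono)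
      then have IH: "tr ?V B f ` carrier (M ?V) \<subseteq> N"
        using V by (rule less.hyps)
      have gQ: "gmap \<Gamma> ?Q ?U (\<lambda>x. x)" and gY: "gmap \<Gamma> ?V ?U (\<lambda>x. x)"
        using A Q V U QX by (auto intro!: gmap_sub_sub)
      then have cop: "gset_coproduct \<Gamma> ?Q ?V ?U (\<lambda>x. x) (\<lambda>x. x)"
        using QX by (auto simp: gset_coproduct_def)
      show ?thesis
      proof (rule image_subsetI)
        fix z assume z: "z \<in> carrier (M ?U)"
        define u where "u = res ?Q ?U (\<lambda>x. x) z"
        define v where "v = res ?V ?U (\<lambda>x. x) z"
        have uv: "u \<in> carrier (M ?Q)" "v \<in> carrier (M ?V)"
          using z gQ gY by (auto simp: u_def v_def intro: res_closed)
        have "tr ?U B f z = tr ?U B f (tr ?Q ?U (\<lambda>x. x) u \<oplus>\<^bsub>M ?U\<^esub> tr ?V ?U (\<lambda>x. x) v)"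
          using coproduct_decomposition[OF cop z] by (simp add: u_def v_def)
        also have "\<dots> = tr ?Q B f u \<oplus>\<^bsub>M B\<^esub> tr ?V B f v"
          using uv tr_closed[OF gQ] tr_closed[OF gY] tr_comp[OF gQ fX] tr_comp[OF gY fX] by simp
        also have "\<dots> \<in> N"
          using uv IH orbits[OF xA] by (intro add) (auto simp: Q_def)
        finally show "tr ?U B f z \<in> N" .
      qed
    qed
  qed
  have inv: "invariant_subset \<Gamma> A (pts A)"
    by (simp add: invariant_subset_def act_closed[OF A])
  let ?A = "sub_gset A (pts A)"
  \<comment> \<open>As records, \<open>A\<close> and \<open>sub_gset A (pts A)\<close> may differ,
    because the action of elements outside the carrier is unconstrained. The identity map and
    functoriality carry the claim over to \<open>A\<close>.\<close>
  have g: "gmap \<Gamma> A ?A (\<lambda>x. x)"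
    using A finite_sub_gset[OF A inv] by (auto simp: gmap_def)
  have "tr A B f z \<in> N" if "z \<in> carrier (M A)" for z
    using tr_comp[OF g gmap_sub_gset[OF f inv] that] tr_closed[OF g that] *[OF inv] by auto
  then show ?thesis by blast
qed

text \<open>The inclusion of stabilizers gives an equivariant map from the orbit \<open>A\<close> to
  \<open>B\<close> taking \<open>x\<close> to \<open>y\<close>. Its composite with \<open>g\<close>
  agrees with \<open>h\<close> at \<open>x\<close>, hence on the whole orbit, so the transfer along
  \<open>h\<close> factors through the transfer along \<open>g\<close>.\<close>

lemma tr_image_subset_of_stabilizer:
  assumes h: "gmap \<Gamma> A C h" and x: "x \<in> pts A" "pts A = orbit \<Gamma> (act A) x"
    and g: "gmap \<Gamma> B C g" and y: "y \<in> pts B" "g y = h x"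
    and stab: "stabilizer \<Gamma> (act A) x \<subseteq> stabilizer \<Gamma> (act B) y"
  shows "tr A C h ` carrier (M A) \<subseteq> tr B C g ` carrier (M B)"
proof -
  have fA: "finite_gset \<Gamma> A" and fB: "finite_gset \<Gamma> B"
    using h g by (auto simp: gmap_def)
  obtain f where f: "gmap \<Gamma> A B f" "f x = y"
    using ex_gmap_from_orbit[OF fA x fB y(1) stab] .
  have gf: "gmap \<Gamma> A C (\<lambda>a. g (f a))"
    using f(1) g by (auto simp: gmap_def Pi_iff)
  have "h a = g (f a)" if "a \<in> pts A" for a
    using gmap_from_orbit_unique[OF h gf x(2,1) _ that] y(2) f(2) by simp
  then have "tr A C h u = tr B C g (tr A B f u)" if "u \<in> carrier (M A)" for u
    using tr_cong[OF h _ that, of "\<lambda>a. g (f a)"] tr_comp[OF f(1) g that] by simp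
  then show ?thesis
    using tr_closed[OF f(1)] by auto
qed

end

section \<open>Permutations of a prime number of points\<close>

text \<open>A permutation that preserves the equality pattern of \<open>t\<close> and takes 1 to
  \<open>i\<close> carries the fibre through 1 onto the fibre through \<open>i\<close>. So the
  fibres have a common size dividing \<open>p\<close>, and size \<open>p\<close> would make
  \<open>t\<close> constant.\<close>

lemma fibres_of_transitive_invariant_map:
  assumes p: "Factorial_Ring.prime (p::nat)"
    and trans: "\<And>i. i \<in> {1..p} \<Longrightarrow> \<exists>\<sigma>. \<sigma> permutes {1..p} \<and> \<sigma> 1 = i \<and>
      (\<forall>j\<in>{1..p}. \<forall>k\<in>{1..p}. t (\<sigma> j) = t (\<sigma> k) \<longleftrightarrow> t j = t k)"
    and nonconst: "\<exists>i\<in>{1..p}. \<exists>j\<in>{1..p}. t i \<noteq> t j"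
  shows "inj_on t {1..p}"
proof -
  define F where "F i = {k \<in> {1..p}. t k = t i}" for i
  have one: "1 \<in> {1..p}" using prime_ge_1_nat[OF p] by simp
  have card_F: "card (F i) = card (F 1)" if i: "i \<in> {1..p}" for i
  proof -
    obtain \<sigma> where \<sigma>: "\<sigma> permutes {1..p}" "\<sigma> 1 = i"
      and t: "\<And>j k. j \<in> {1..p} \<Longrightarrow> k \<in> {1..p} \<Longrightarrow> t (\<sigma> j) = t (\<sigma> k) \<longleftrightarrow> t j = t k"
      using trans[OF i] by blast
    have "F i = \<sigma> ` F 1"
    proof (intro subset_antisym subsetI)
      fix k assume k: "k \<in> F i"
      then obtain j where j: "j \<in> {1..p}" "k = \<sigma> j"
        using permutes_image[OF \<sigma>(1)] unfolding F_def by blast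
      with k t[OF j(1) one] \<sigma>(2) show "k \<in> \<sigma> ` F 1"
        by (auto simp: F_def)
    next
      fix k assume "k \<in> \<sigma> ` F 1"
      then show "k \<in> F i"
        using t[OF _ one] \<sigma>(2) permutes_in_image[OF \<sigma>(1)] by (auto simp: F_def)
    qed
    then show ?thesis
      using card_image[OF inj_on_subset[OF permutes_inj[OF \<sigma>(1)]]] by simp
  qed
  \<comment> \<open>Counting \<open>{1..p}\<close> fibre by fibre exhibits \<open>p\<close> as the
    number of fibres times their common size.\<close>
  have "p = (\<Sum>k\<in>{1..p}. 1)" by simp
  also have "\<dots> = (\<Sum>c\<in>t ` {1..p}. \<Sum>k\<in>{k \<in> {1..p}. t k = c}. 1)"
    by (rule sum.image_gen) simp
  also have "\<dots> = (\<Sum>c\<in>t ` {1..p}. card (F 1))"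
  proof (rule sum.cong[OF refl])
    fix c assume "c \<in> t ` {1..p}"
    then obtain i where "i \<in> {1..p}" "c = t i" by blast
    then show "(\<Sum>k\<in>{k \<in> {1..p}. t k = c}. 1) = card (F 1)"
      using card_F[of i] by (simp add: F_def)
  qed
  also have "\<dots> = card (t ` {1..p}) * card (F 1)" by simp
  finally have "card (F 1) dvd p" by (metis dvd_triv_right)
  then have "card (F 1) = 1 \<or> card (F 1) = p"
    using p by (simp add: prime_nat_iff)
  then show ?thesis
  proof
    assume "card (F 1) = p"
    then have "F 1 = {1..p}"
      by (intro card_subset_eq) (auto simp: F_def)
    then have "t i = t j" if "i \<in> {1..p}" "j \<in> {1..p}" for i j
      using that unfolding F_def by (metis (mono_tags, lifting) mem_Collect_eq)
    with nonconst show ?thesis by blast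
  next
    assume 1: "card (F 1) = 1"
    show ?thesis
    proof (rule inj_onI)
      fix i j assume ij: "i \<in> {1..p}" "j \<in> {1..p}" "t i = t j"
      then have "card (F i) = 1" using card_F[of i] 1 by simp
      then obtain k where "F i = {k}" by (auto simp: card_1_singleton_iff)
      moreover have "i \<in> F i" "j \<in> F i" using ij by (auto simp: F_def)
      ultimately show "i = j" by auto
    qed
  qed
qed

text \<open>Transitivity makes \<open>p\<close> a divisor of the order of \<open>T\<close>, so
  \<open>T\<close> has a subgroup of order \<open>p\<close>. A nontrivial element of it has a cycle
  of length \<open>p\<close>, which leaves no room for other points.\<close>

lemma transitive_contains_long_cycle:
  assumes p: "Factorial_Ring.prime p" and T: "subgroup T (sym_group p)"
    and trans: "\<And>i. i \<in> {1..p} \<Longrightarrow> \<exists>\<sigma>\<in>T. \<sigma> 1 = i"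
  shows "contains_long_cycle p T"
proof -
  interpret S: group "sym_group p" by (rule sym_group_is_group)
  have perm: "\<sigma> permutes {1..p}" if "\<sigma> \<in> T" for \<sigma>
    using subgroup.subset[OF T] that by (auto simp: sym_group_carrier)
  have finT: "finite T"
    by (rule finite_subset[OF _ finite_permutations[of "{1..p}"]]) (use perm in auto)
  define K where "K = (sym_group p)\<lparr>carrier := T\<rparr>"
  interpret K: group K
    unfolding K_def using T S.group_axioms by (rule subgroup.subgroup_is_group)
  define E where "E = \<lparr>pts = {1..p}, act = \<lambda>\<sigma>. \<lambda>i\<in>{1..p}. \<sigma> i\<rparr>"
  have "finite_gset K E"
    by (rule finite_gsetI)
      (use K.group_axioms permutes_in_image[OF perm] in
        \<open>simp_all add: E_def K_def sym_group_mult sym_group_one del: atLeastAtMost_iff\<close>)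
  then interpret act: group_action K "{1..p}" "\<lambda>\<sigma>. \<lambda>i\<in>{1..p}. \<sigma> i"
    by (simp add: finite_gset_def E_def)
  have one: "1 \<in> {1..p}" using prime_ge_1_nat[OF p] by simp
  have "orbit K (\<lambda>\<sigma>. \<lambda>i\<in>{1..p}. \<sigma> i) 1 = {1..p}"
  proof (intro subset_antisym subsetI)
    fix i assume "i \<in> orbit K (\<lambda>\<sigma>. \<lambda>i\<in>{1..p}. \<sigma> i) 1"
    then show "i \<in> {1..p}" using perm permutes_in_image one by (fastforce simp: orbit_def K_def)
  next
    fix i assume "i \<in> {1..p}"
    then show "i \<in> orbit K (\<lambda>\<sigma>. \<lambda>i\<in>{1..p}. \<sigma> i) 1"
      using trans[of i] one by (auto simp: orbit_def K_def)
  qed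
  \<comment> \<open>The exponent 1 and the stabilizer as cofactor put the order into the form that
    \<open>sylow_thm\<close> expects.\<close>
  then have "order K = p ^ 1 * card (stabilizer K (\<lambda>\<sigma>. \<lambda>i\<in>{1..p}. \<sigma> i) 1)"
    using act.orbit_stabilizer_theorem[OF one] by simp
  then have "\<exists>Q. subgroup Q K \<and> card Q = p ^ 1"
    by (rule sylow_thm[OF p K.group_axioms]) (use finT in \<open>simp add: K_def\<close>)
  then obtain Q where Q: "subgroup Q K" "card Q = p" by auto
  have "\<one>\<^bsub>K\<^esub> \<in> Q" using Q(1) by (rule subgroup.one_closed)
  moreover have "1 < card Q" using Q(2) prime_gt_1_nat[OF p] by simp
  ultimately obtain \<sigma> where \<sigma>: "\<sigma> \<in> Q" "\<sigma> \<noteq> \<one>\<^bsub>K\<^esub>"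
    by (metis card_1_singleton_iff is_singletonI' is_singleton_def less_irrefl One_nat_def empty_iff)
  have \<sigma>T: "\<sigma> \<in> T" using subgroup.subset[OF Q(1)] \<sigma>(1) by (auto simp: K_def)
  note \<sigma>p = perm[OF \<sigma>T]
  have perm\<sigma>: "permutation \<sigma>" using \<sigma>p by (auto simp: permutation_permutes)
  have pow: "\<sigma> [^]\<^bsub>K\<^esub> n = \<sigma> ^^ n" for n :: nat
    by (induction n) (auto simp: K_def sym_group_def nat_pow_def funpow_swap1 fun_eq_iff)
  interpret KQ: group "K\<lparr>carrier := Q\<rparr>"
    using Q(1) K.group_axioms by (rule subgroup.subgroup_is_group)
  have "\<sigma> [^]\<^bsub>K\<lparr>carrier := Q\<rparr>\<^esub> order (K\<lparr>carrier := Q\<rparr>) = \<one>\<^bsub>K\<lparr>carrier := Q\<rparr>\<^esub>"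
    by (rule KQ.pow_order_eq_1) (use \<sigma>(1) in simp)
  then have "\<sigma> ^^ p = id"
    using Q(2) pow[of p] by (simp add: order_def nat_pow_def K_def sym_group_one)
  obtain c where c: "\<sigma> c \<noteq> c"
    using \<sigma>(2) by (auto simp: K_def sym_group_one fun_eq_iff)
  \<comment> \<open>The cycle through the moved point \<open>c\<close> has length dividing
    \<open>p\<close> and larger than 1.\<close>
  have "least_power \<sigma> c dvd p"
    using \<open>\<sigma> ^^ p = id\<close> by (intro least_power_minimal) simp
  moreover have "least_power \<sigma> c > Suc 0"
    using perm\<sigma> c by (rule least_power_gt_one)
  ultimately have lp: "least_power \<sigma> c = p"
    using p by (auto simp: prime_nat_iff)
  let ?cs = "support \<sigma> c"
  have cyc: "cycle ?cs" using perm\<sigma> by (rule cycle_of_permutation)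
  have "c \<in> {1..p}" using c \<sigma>p by (auto simp: permutes_def)
  then have "set ?cs \<subseteq> {1..p}"
    using permutes_in_image[OF permutes_funpow[OF \<sigma>p]] by auto
  moreover have "card (set ?cs) = p"
    using distinct_card[OF cyc] lp by simp
  ultimately have set: "set ?cs = {1..p}"
    by (intro card_subset_eq) auto
  have "cycle_of_list ?cs = \<sigma>"
  proof
    fix i show "cycle_of_list ?cs i = \<sigma> i"
    proof (cases "i \<in> set ?cs")
      case True
      then show ?thesis by (rule cycle_restrict[OF perm\<sigma>, symmetric])
    next
      case False
      then show ?thesis
        using id_outside_supp[OF False] \<sigma>p set by (metis permutes_not_in)
    qed
  qed
  with cyc set \<sigma>T show ?thesis
    unfolding contains_long_cycle_def by metis
qed

text \<open>Powers of the cycle act on the list \<open>cs\<close> by rotation, so a suitable power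
  takes any position to any other.\<close>

lemma long_cycle_transitive:
  assumes "subgroup T (sym_group p)" "contains_long_cycle p T" "i \<in> {1..p}" "j \<in> {1..p}"
  shows "\<exists>\<sigma>\<in>T. \<sigma> i = j"
proof -
  interpret subgroup T "sym_group p" by fact
  obtain cs where cs: "cycle cs" "set cs = {1..p}" "cycle_of_list cs \<in> T"
    using assms(2) by (auto simp: contains_long_cycle_def)
  let ?c = "cycle_of_list cs"
  have pow: "?c ^^ n \<in> T" for n
    using cs(3) one_closed m_closed
    by (induction n) (auto simp: sym_group_one sym_group_mult)
  obtain k l where kl: "k < length cs" "l < length cs" "cs ! k = i" "cs ! l = j"
    using assms(3,4) cs(2) by (metis in_set_conv_nth)
  \<comment> \<open>Adding \<open>length cs\<close> before subtracting \<open>k\<close> avoids a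
    truncated difference when \<open>l < k\<close>; modulo \<open>length cs\<close> the rotation
    takes position \<open>k\<close> to position \<open>l\<close>.\<close>
  define n where "n = length cs - k + l"
  have "(?c ^^ n) i = map (?c ^^ n) cs ! k" using kl by simp
  also have "\<dots> = rotate n cs ! k" using cyclic_rotation[OF cs(1)] by simp
  also have "\<dots> = cs ! ((n + k) mod length cs)"
    using kl(1) by (simp add: nth_rotate)
  also have "n + k = length cs + l" using kl by (simp add: n_def)
  also have "cs ! ((length cs + l) mod length cs) = j" using kl by simp
  finally show ?thesis using pow by blast
qed

section \<open>Young subgroups as setwise stabilizers\<close>

text \<open>A permutation that preserves the first block also preserves its complement and therefore
  splits into two factors. In this form membership is a condition on images, which is easy to check
  for conjugates.\<close>

lemma young_subgroup_eq:
  "young_subgroup i j = {\<rho>. \<rho> permutes {1..i + j} \<and> \<rho> ` {1..i} = {1..i}}"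
proof (intro subset_antisym subsetI)
  fix \<rho> assume "\<rho> \<in> young_subgroup i j"
  then obtain \<sigma> \<tau> where \<rho>: "\<rho> = \<sigma> \<circ> \<tau>" and \<sigma>: "\<sigma> permutes {1..i}" and \<tau>: "\<tau> permutes {i + 1..i + j}"
    by (auto simp: young_subgroup_def)
  have "\<sigma> permutes {1..i + j}" "\<tau> permutes {1..i + j}"
    using permutes_subset[OF \<sigma>] permutes_subset[OF \<tau>] by auto
  then have "\<rho> permutes {1..i + j}" unfolding \<rho> by (rule permutes_compose[rotated])
  moreover have "\<tau> ` {1..i} = {1..i}"
    using permutes_not_in[OF \<tau>] by (force simp: image_iff)
  then have "\<rho> ` {1..i} = {1..i}"
    using permutes_image[OF \<sigma>] by (metis \<rho> image_comp)
  ultimately show "\<rho> \<in> {\<rho>. \<rho> permutes {1..i + j} \<and> \<rho> ` {1..i} = {1..i}}" by simp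
next
  fix \<rho> assume "\<rho> \<in> {\<rho>. \<rho> permutes {1..i + j} \<and> \<rho> ` {1..i} = {1..i}}"
  then have \<rho>: "\<rho> permutes {1..i + j}" and im: "\<rho> ` {1..i} = {1..i}" by auto
  \<comment> \<open>The two factors are the restrictions of \<open>\<rho>\<close> to the blocks,
    extended by the identity.\<close>
  define \<sigma> where "\<sigma> k = (if k \<in> {1..i} then \<rho> k else k)" for k
  define \<tau> where "\<tau> k = (if k \<in> {i + 1..i + j} then \<rho> k else k)" for k
  have inj: "inj \<rho>" using \<rho> by (rule permutes_inj)
  have "\<rho> ` {i + 1..i + j} = \<rho> ` ({1..i + j} - {1..i})" by (rule arg_cong[where f = "image \<rho>"]) auto
  also have "\<dots> = {i + 1..i + j}"
    using permutes_image[OF \<rho>] im by (auto simp: image_set_diff[OF inj])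
  finally have im': "\<rho> ` {i + 1..i + j} = {i + 1..i + j}" .
  have \<sigma>: "\<sigma> permutes {1..i}"
    by (rule bij_imp_permutes)
      (use im inj in \<open>auto simp: \<sigma>_def bij_betw_def inj_on_def inj_def image_def\<close>)
  moreover have "\<tau> permutes {i + 1..i + j}"
    by (rule bij_imp_permutes)
      (use im' inj in \<open>auto simp: \<tau>_def bij_betw_def inj_on_def inj_def image_def\<close>)
  moreover have "\<rho> = \<sigma> \<circ> \<tau>"
  proof
    fix k
    consider "k \<in> {1..i}" | "k \<in> {i + 1..i + j}" | "k \<notin> {1..i + j}" by force
    then show "\<rho> k = (\<sigma> \<circ> \<tau>) k"
    proof cases
      case 2
      then have "\<rho> k \<in> {i + 1..i + j}" using im' by blast
      with 2 show ?thesis by (simp add: \<sigma>_def \<tau>_def)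
    qed (use permutes_not_in[OF \<rho>] in \<open>auto simp: \<sigma>_def \<tau>_def\<close>)
  qed
  ultimately show "\<rho> \<in> young_subgroup i j"
    by (auto simp: young_subgroup_def)
qed

lemma subgroup_young_subgroup: "subgroup (young_subgroup i j) (sym_group (i + j))"
proof (rule group.subgroupI[OF sym_group_is_group])
  show "young_subgroup i j \<subseteq> carrier (sym_group (i + j))"
    by (auto simp: young_subgroup_eq sym_group_carrier)
  have "id \<in> young_subgroup i j" by (simp add: young_subgroup_eq permutes_id)
  then show "young_subgroup i j \<noteq> {}" by blast
  fix \<rho> assume \<rho>: "\<rho> \<in> young_subgroup i j"
  then have per: "\<rho> permutes {1..i + j}" by (simp add: young_subgroup_eq)
  have "inv' \<rho> ` {1..i} = inv' \<rho> ` \<rho> ` {1..i}" using \<rho> by (simp add: young_subgroup_eq)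
  also have "\<dots> = {1..i}" using permutes_inj[OF per] by (simp add: image_comp)
  finally show "inv\<^bsub>sym_group (i + j)\<^esub> \<rho> \<in> young_subgroup i j"
    using per by (simp add: sym_group_inv_equality sym_group_carrier young_subgroup_eq permutes_inv)
  fix \<tau> assume "\<tau> \<in> young_subgroup i j"
  with \<rho> show "\<rho> \<otimes>\<^bsub>sym_group (i + j)\<^esub> \<tau> \<in> young_subgroup i j"
    unfolding young_subgroup_eq sym_group_mult
    by (metis (mono_tags, lifting) image_comp mem_Collect_eq permutes_compose)
qed

text \<open>Bijections between the two sets and between their complements, which have equal size,
  are glued. The result serves to move an invariant set of positions to the front, where its setwise
  stabilizer is a Young subgroup.\<close>

lemma ex_permutes_onto_initial_segment:
  assumes "P \<subseteq> {1..n::nat}"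
  shows "\<exists>\<tau>. \<tau> permutes {1..n} \<and> \<tau> ` P = {1..card P}"
proof -
  have fin: "finite P" using assms by (rule finite_subset) simp
  have le: "card P \<le> n" using card_mono[OF _ assms] by simp
  obtain f where f: "bij_betw f P {1..card P}"
    using fin by (metis card_atLeastAtMost diff_Suc_1 finite_atLeastAtMost finite_same_card_bij)
  have "card ({1..n} - P) = card ({1..n} - {1..card P})"
    using assms le fin by (simp add: card_Diff_subset)
  then obtain g where g: "bij_betw g ({1..n} - P) ({1..n} - {1..card P})"
    by (metis finite_Diff finite_atLeastAtMost finite_same_card_bij)
  define \<tau> where "\<tau> k = (if k \<in> P then f k else if k \<in> {1..n} then g k else k)" for k
  have "bij_betw \<tau> (P \<union> ({1..n} - P)) ({1..card P} \<union> ({1..n} - {1..card P}))"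
  proof (rule bij_betw_combine)
    show "bij_betw \<tau> P {1..card P}"
      using f by (rule bij_betw_cong[THEN iffD1, rotated]) (simp add: \<tau>_def)
    show "bij_betw \<tau> ({1..n} - P) ({1..n} - {1..card P})"
      using g by (rule bij_betw_cong[THEN iffD1, rotated]) (simp add: \<tau>_def)
  qed auto
  moreover have "P \<union> ({1..n} - P) = {1..n}" "{1..card P} \<union> ({1..n} - {1..card P}) = {1..n}"
    using assms le by auto
  ultimately have "\<tau> permutes {1..n}"
    using assms by (intro bij_imp_permutes) (auto simp: \<tau>_def)
  moreover have "\<tau> ` P = {1..card P}"
    using f by (auto simp: \<tau>_def bij_betw_def)
  ultimately show ?thesis by blast
qed

section \<open>Coset spaces and fibre powers\<close>

lemma group_G_Sigma: "group G \<Longrightarrow> group (G_Sigma G m)"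
  by (simp add: DirProd_group sym_group_is_group)

lemma finite_carrier_sym_group: "finite (carrier (sym_group m))"
  by (simp add: sym_group_def finite_permutations)

section \<open>Left cosets and products of subsets\<close>

context group
begin

lemma lcosetsI: "g \<in> carrier G \<Longrightarrow> g <# K \<in> lcosets K"
  by (auto simp: LCOSETS_def)

lemma lcosetsE:
  assumes "C \<in> lcosets K"
  obtains g where "g \<in> carrier G" "C = g <# K"
  using assms by (auto simp: LCOSETS_def)

lemma lcosets_subset: "\<lbrakk>subgroup K G; C \<in> lcosets K\<rbrakk> \<Longrightarrow> C \<subseteq> carrier G"
  using lcosets_part_G by blast

lemma l_coset_lcosets:
  "\<lbrakk>subgroup K G; g \<in> carrier G; C \<in> lcosets K\<rbrakk> \<Longrightarrow> g <# C \<in> lcosets K"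
  by (auto elim!: lcosetsE intro!: lcosetsI simp: lcos_m_assoc subgroup.subset)

lemma l_coset_inj:
  assumes "g \<in> carrier G" "C \<subseteq> carrier G" "D \<subseteq> carrier G" "g <# C = g <# D"
  shows "C = D"
proof -
  have "inv g <# (g <# C) = inv g <# (g <# D)" using assms(4) by simp
  then show ?thesis using assms(1-3) by (simp add: lcos_m_assoc lcos_mult_one)
qed

lemma l_coset_eq_subgroup_iff:
  assumes "subgroup K G" "g \<in> carrier G"
  shows "g <# K = K \<longleftrightarrow> g \<in> K"
  using assms lcos_self[of g K] coset_join3[of g K] by auto

lemma l_coset_eq_iff:
  assumes K: "subgroup K G" and "g \<in> carrier G" "h \<in> carrier G"
  shows "g <# K = h <# K \<longleftrightarrow> inv h \<otimes> g \<in> K"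
proof -
  have "g <# K = h <# K \<longleftrightarrow> inv h <# (g <# K) = inv h <# (h <# K)"
    using assms l_coset_inj[of "inv h" "g <# K" "h <# K"]
    by (auto simp only: l_coset_subset_G subgroup.subset inv_closed)
  also have "\<dots> \<longleftrightarrow> inv h \<otimes> g <# K = K"
    using assms by (simp add: lcos_m_assoc lcos_mult_one subgroup.subset)
  also have "\<dots> \<longleftrightarrow> inv h \<otimes> g \<in> K"
    using assms by (simp add: l_coset_eq_subgroup_iff)
  finally show ?thesis .
qed

text \<open>A single element \<open>c\<close> of \<open>C\<close> already gives
  \<open>c <# K = K\<close>. This evaluates the projections to \<open>G/L\<close>, which are defined
  as products of subsets with \<open>L\<close>.\<close>

lemma set_mult_subgroup_absorb:
  assumes K: "subgroup K G" and "C \<subseteq> K" "C \<noteq> {}"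
  shows "C <#> K = K"
proof
  show "C <#> K \<subseteq> K"
    using assms(2) subgroup.m_closed[OF K] by (auto simp: set_mult_def)
  obtain c where c: "c \<in> C" using assms(3) by blast
  with assms have cK: "c \<in> K" "c \<in> carrier G" using subgroup.subset[OF K] by auto
  then have "K = c <# K" using l_coset_eq_subgroup_iff[OF K, of c] by simp
  also have "\<dots> \<subseteq> C <#> K" using c by (auto simp: set_mult_def l_coset_def)
  finally show "K \<subseteq> C <#> K" .
qed

section \<open>Coset spaces of \<open>G\<close> and of \<open>G_Sigma G m\<close>, and the
  projections between them\<close>

lemma finite_trivial_Sigma_coset_gset:
  assumes "finite (carrier G)" "subgroup L G"
  shows "finite_gset (G_Sigma G m) (trivial_Sigma (coset_gset G L))"
proof (rule finite_gsetI)
  show "group (G_Sigma G m)" by (intro group_G_Sigma group_axioms)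
  show "finite (pts (trivial_Sigma (coset_gset G L)))"
    using assms(1) by (simp add: trivial_Sigma_def coset_gset_def LCOSETS_def)
qed (use assms(2) in \<open>auto simp: trivial_Sigma_def coset_gset_def l_coset_lcosets
    lcosets_subset lcos_mult_one lcos_m_assoc\<close>)

lemma act_trivial_Sigma_coset_gset:
  assumes "subgroup L G" "g \<in> carrier G" "h \<in> carrier G"
  shows "act (trivial_Sigma (coset_gset G L)) (g, \<sigma>) (Coset (h <# L)) = Coset (g \<otimes> h <# L)"
  using assms by (simp add: trivial_Sigma_def coset_gset_def lcosetsI lcos_m_assoc subgroup.subset)

lemma finite_prod_coset_gset:
  assumes "finite (carrier G)" "subgroup K (G_Sigma G m)"
  shows "finite_gset (G_Sigma G m) (prod_coset_gset G m K)"
proof -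
  interpret P: group "G_Sigma G m" by (intro group_G_Sigma group_axioms)
  show ?thesis
  proof (rule finite_gsetI)
    show "group (G_Sigma G m)" by (rule P.group_axioms)
    have "finite (carrier (G_Sigma G m))"
      using assms(1) finite_carrier_sym_group by simp
    then show "finite (pts (prod_coset_gset G m K))"
      by (simp add: prod_coset_gset_def LCOSETS_def)
  qed (use assms(2) in \<open>auto simp: prod_coset_gset_def P.l_coset_lcosets
      P.lcosets_subset P.lcos_mult_one P.lcos_m_assoc
      simp del: carrier_DirProd one_DirProd\<close>)
qed

text \<open>These facts allow a coset space to serve in \<open>tr_image_subset_of_stabilizer\<close>
  both as the source and as the intermediate set.\<close>

lemma
  assumes "finite (carrier G)" and K: "subgroup K (G_Sigma G m)"
  shows base_point_prod_coset_gset: "ProdCoset K \<in> pts (prod_coset_gset G m K)"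
    and orbit_prod_coset_gset:
      "pts (prod_coset_gset G m K) = orbit (G_Sigma G m) (act (prod_coset_gset G m K)) (ProdCoset K)"
    and stabilizer_prod_coset_gset:
      "stabilizer (G_Sigma G m) (act (prod_coset_gset G m K)) (ProdCoset K) = K"
proof -
  interpret P: group "G_Sigma G m" by (intro group_G_Sigma group_axioms)
  have K1: "\<one>\<^bsub>G_Sigma G m\<^esub> <#\<^bsub>G_Sigma G m\<^esub> K = K"
    using subgroup.subset[OF K] by (rule P.lcos_mult_one)
  have mem: "K \<in> lcosets\<^bsub>G_Sigma G m\<^esub> K"
    using P.lcosetsI[OF P.one_closed, of K] K1 by simp
  then show "ProdCoset K \<in> pts (prod_coset_gset G m K)"
    by (simp add: prod_coset_gset_def)
  show "pts (prod_coset_gset G m K) =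
      orbit (G_Sigma G m) (act (prod_coset_gset G m K)) (ProdCoset K)"
    using mem by (auto simp: orbit_def prod_coset_gset_def LCOSETS_def)
  show "stabilizer (G_Sigma G m) (act (prod_coset_gset G m K)) (ProdCoset K) = K"
    using mem subgroup.subset[OF K] P.l_coset_eq_subgroup_iff[OF K]
    by (auto simp: stabilizer_def prod_coset_gset_def simp del: carrier_DirProd)
qed

text \<open>The first projection of a translate of \<open>K\<close> is the translate of
  \<open>fst\<close> K\<open>, and\<close>L\<open>absorbs\<close>fst \<open>K\<close>. So the
  product formula in \<open>coset_proj\<close> is the expected map on representatives.\<close>

lemma coset_proj_l_coset:
  assumes K: "subgroup K (G_Sigma G m)" and L: "subgroup L G" "fst ` K \<subseteq> L"
    and \<gamma>: "\<gamma> \<in> carrier (G_Sigma G m)"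
  shows "coset_proj G L (ProdCoset (\<gamma> <#\<^bsub>G_Sigma G m\<^esub> K)) = Coset (fst \<gamma> <# L)"
proof -
  have ne: "fst ` K \<noteq> {}" using subgroup.one_closed[OF K] by auto
  have "fst ` (\<gamma> <#\<^bsub>G_Sigma G m\<^esub> K) = fst \<gamma> <# (fst ` K)"
    by (force simp: l_coset_def mult_DirProd' image_iff)
  then have "fst ` (\<gamma> <#\<^bsub>G_Sigma G m\<^esub> K) <#> L = fst \<gamma> <# (fst ` K <#> L)"
    using \<gamma> L subgroup.subset[OF L(1)] by (subst setmult_lcos_assoc[symmetric]) auto
  then show ?thesis
    using set_mult_subgroup_absorb[OF L ne] by (simp add: coset_proj_def)
qed

lemma gmap_coset_proj:
  assumes fin: "finite (carrier G)" and K: "subgroup K (G_Sigma G m)"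
    and L: "subgroup L G" "fst ` K \<subseteq> L"
  shows "gmap (G_Sigma G m) (prod_coset_gset G m K) (trivial_Sigma (coset_gset G L)) (coset_proj G L)"
proof -
  interpret P: group "G_Sigma G m" by (intro group_G_Sigma group_axioms)
  have "coset_proj G L x \<in> pts (trivial_Sigma (coset_gset G L))"
    if "x \<in> pts (prod_coset_gset G m K)" for x
    using that coset_proj_l_coset[OF K L]
    by (auto simp: prod_coset_gset_def trivial_Sigma_def coset_gset_def
        elim!: P.lcosetsE intro!: lcosetsI)
  moreover have "coset_proj G L (act (prod_coset_gset G m K) \<gamma> x) =
      act (trivial_Sigma (coset_gset G L)) \<gamma> (coset_proj G L x)"
    if \<gamma>: "\<gamma> \<in> carrier (G_Sigma G m)" and x: "x \<in> pts (prod_coset_gset G m K)" for \<gamma> x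
  proof -
    obtain \<delta> where \<delta>: "\<delta> \<in> carrier (G_Sigma G m)" "x = ProdCoset (\<delta> <#\<^bsub>G_Sigma G m\<^esub> K)"
      using x by (auto simp: prod_coset_gset_def elim!: P.lcosetsE)
    have "act (prod_coset_gset G m K) \<gamma> x = ProdCoset (\<gamma> \<otimes>\<^bsub>G_Sigma G m\<^esub> \<delta> <#\<^bsub>G_Sigma G m\<^esub> K)"
      using \<gamma> \<delta> x subgroup.subset[OF K] by (simp add: prod_coset_gset_def P.lcos_m_assoc del: carrier_DirProd)
    then have "coset_proj G L (act (prod_coset_gset G m K) \<gamma> x) = Coset (fst \<gamma> \<otimes> fst \<delta> <# L)"
      using coset_proj_l_coset[OF K L P.m_closed[OF \<gamma> \<delta>(1)]] by (simp add: mult_DirProd')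
    also have "\<dots> = act (trivial_Sigma (coset_gset G L)) \<gamma> (coset_proj G L x)"
      using act_trivial_Sigma_coset_gset[OF L(1), of "fst \<gamma>" "fst \<delta>" "snd \<gamma>"] \<gamma> \<delta>
        coset_proj_l_coset[OF K L \<delta>(1)] by auto
    finally show ?thesis .
  qed
  ultimately show ?thesis
    using finite_prod_coset_gset[OF fin K] finite_trivial_Sigma_coset_gset[OF fin L(1)]
    by (auto simp: gmap_def simp del: carrier_DirProd)
qed

lemma coset_proj_base_point:
  assumes K: "subgroup K (G_Sigma G m)" and L: "subgroup L G" "fst ` K \<subseteq> L"
  shows "coset_proj G L (ProdCoset K) = Coset L"
  using set_mult_subgroup_absorb[OF L] subgroup.one_closed[OF K] by (auto simp: coset_proj_def)

section \<open>The complement of the diagonal in a fibre power\<close>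

text \<open>A tuple is diagonal exactly if it is constant: as \<open>m\<close> is positive, the
  entry at 1 supplies the coset, and extensionality fixes the values outside
  \<open>{1..m}\<close>.\<close>

lemma Tuple_in_Z_gset_iff:
  assumes "0 < m"
  shows "Tuple t \<in> pts (Z_gset G m L H) \<longleftrightarrow>
    t \<in> {1..m} \<rightarrow>\<^sub>E lcosets H \<and>
    (\<forall>i\<in>{1..m}. \<forall>j\<in>{1..m}. t i <#> L = t j <#> L) \<and>
    (\<exists>i\<in>{1..m}. \<exists>j\<in>{1..m}. t i \<noteq> t j)"
proof -
  have "(\<exists>C\<in>lcosets H. t = (\<lambda>i\<in>{1..m}. C)) \<longleftrightarrow> \<not> (\<exists>i\<in>{1..m}. \<exists>j\<in>{1..m}. t i \<noteq> t j)"
    if t: "t \<in> {1..m} \<rightarrow>\<^sub>E lcosets H"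
  proof
    assume *: "\<not> (\<exists>i\<in>{1..m}. \<exists>j\<in>{1..m}. t i \<noteq> t j)"
    have "1 \<in> {1..m}" using assms by simp
    moreover from this have "t 1 \<in> lcosets H" using t by (auto simp: PiE_iff)
    moreover have "t = (\<lambda>i\<in>{1..m}. t 1)"
      using * \<open>1 \<in> {1..m}\<close> t by (intro ext) (metis PiE_arb restrict_apply)
    ultimately show "\<exists>C\<in>lcosets H. t = (\<lambda>i\<in>{1..m}. C)" by blast
  qed auto
  moreover have "Tuple t \<in> diagonal_pts G m H \<longleftrightarrow> (\<exists>C\<in>lcosets H. t = (\<lambda>i\<in>{1..m}. C))"
    unfolding diagonal_pts_def by blast
  moreover have "Tuple t \<in> fibre_power_pts G m L H \<longleftrightarrow>
      t \<in> {1..m} \<rightarrow>\<^sub>E lcosets H \<and> (\<forall>i\<in>{1..m}. \<forall>j\<in>{1..m}. t i <#> L = t j <#> L)"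
    unfolding fibre_power_pts_def by blast
  ultimately show ?thesis
    unfolding Z_gset_def by simp blast
qed

lemma Z_gset_ptsE:
  assumes "x \<in> pts (Z_gset G m L H)"
  obtains t where "x = Tuple t"
  using assms by (auto simp: Z_gset_def fibre_power_pts_def)

lemma act_Z_gset:
  assumes "Tuple t \<in> pts (Z_gset G m L H)" "\<sigma> permutes {1..m}"
  shows "act (Z_gset G m L H) (g, \<sigma>) (Tuple t) = Tuple (\<lambda>i\<in>{1..m}. g <# t (inv' \<sigma> i))"
  using assms by (simp add: Z_gset_def sym_group_carrier)

text \<open>Entries are read off at the inverse permutation, which makes permuting positions a left
  action. Injectivity of left translation keeps translated tuples off the diagonal.\<close>

lemma finite_Z_gset:
  assumes fin: "finite (carrier G)" and L: "subgroup L G" and H: "subgroup H G" and m: "0 < m"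
  shows "finite_gset (G_Sigma G m) (Z_gset G m L H)"
proof (rule finite_gsetI)
  show "group (G_Sigma G m)" by (intro group_G_Sigma group_axioms)
  have "finite ({1..m} \<rightarrow>\<^sub>E lcosets H)"
    using fin by (intro finite_PiE) (auto simp: LCOSETS_def)
  then show "finite (pts (Z_gset G m L H))"
    by (auto simp: Z_gset_def fibre_power_pts_def)
  show "act (Z_gset G m L H) \<gamma> \<in> extensional (pts (Z_gset G m L H))"
    if "\<gamma> \<in> carrier (G_Sigma G m)" for \<gamma>
    by (auto simp: Z_gset_def split: prod.splits)
  have closed: "act (Z_gset G m L H) (g, \<sigma>) (Tuple t) \<in> pts (Z_gset G m L H)"
    if g: "g \<in> carrier G" and \<sigma>: "\<sigma> permutes {1..m}" and t: "Tuple t \<in> pts (Z_gset G m L H)" for g \<sigma> t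
  proof -
    let ?u = "\<lambda>i\<in>{1..m}. g <# t (inv' \<sigma> i)"
    have T: "t i \<in> lcosets H" if "i \<in> {1..m}" for i
      using t that m by (auto simp: Tuple_in_Z_gset_iff PiE_iff)
    have inv: "inv' \<sigma> i \<in> {1..m}" if "i \<in> {1..m}" for i
      using permutes_in_image[OF permutes_inv[OF \<sigma>]] that by blast
    have "?u \<in> {1..m} \<rightarrow>\<^sub>E lcosets H"
      using T inv H g by (auto simp: l_coset_lcosets simp del: atLeastAtMost_iff)
    moreover have "?u i <#> L = g <# (t 1 <#> L)" if "i \<in> {1..m}" for i
    proof -
      have "?u i <#> L = g <# (t (inv' \<sigma> i) <#> L)"
        using that g subgroup.subset[OF L] lcosets_subset[OF H T[OF inv[OF that]]]
        by (simp add: setmult_lcos_assoc)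
      also have "t (inv' \<sigma> i) <#> L = t 1 <#> L"
      proof -
        have "1 \<in> {1..m}" using m by simp
        then show ?thesis
          using t inv[OF that] unfolding Tuple_in_Z_gset_iff[OF m] by blast
      qed
      finally show ?thesis .
    qed
    moreover have "\<exists>i\<in>{1..m}. \<exists>j\<in>{1..m}. ?u i \<noteq> ?u j"
    proof -
      obtain i j where ij: "i \<in> {1..m}" "j \<in> {1..m}" "t i \<noteq> t j"
        using t unfolding Tuple_in_Z_gset_iff[OF m] by blast
      \<comment> \<open>The entries \<open>i\<close> and \<open>j\<close> of \<open>t\<close>
        reappear, translated by \<open>g\<close>, at the positions \<open>\<sigma> i\<close> and
        \<open>\<sigma> j\<close>.\<close>
      have s: "\<sigma> i \<in> {1..m}" "\<sigma> j \<in> {1..m}" using ij permutes_in_image[OF \<sigma>] by blast+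
      have "g <# t i \<noteq> g <# t j"
        using l_coset_inj[OF g lcosets_subset[OF H T] lcosets_subset[OF H T]] ij by blast
      then have "?u (\<sigma> i) \<noteq> ?u (\<sigma> j)"
        using s permutes_inverses(2)[OF \<sigma>] by simp
      with s show ?thesis by blast
    qed
    ultimately have "Tuple ?u \<in> pts (Z_gset G m L H)"
      unfolding Tuple_in_Z_gset_iff[OF m] by simp
    then show ?thesis using act_Z_gset[OF t \<sigma>] by simp
  qed
  then show "act (Z_gset G m L H) \<gamma> x \<in> pts (Z_gset G m L H)"
    if "\<gamma> \<in> carrier (G_Sigma G m)" "x \<in> pts (Z_gset G m L H)" for \<gamma> x
    using that by (cases \<gamma>) (metis Z_gset_ptsE carrier_DirProd mem_Sigma_iff sym_group_carrier)
  show "act (Z_gset G m L H) \<one>\<^bsub>G_Sigma G m\<^esub> x = x" if x: "x \<in> pts (Z_gset G m L H)" for x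
  proof -
    obtain t where t: "x = Tuple t" using x by (rule Z_gset_ptsE)
    have "t \<in> {1..m} \<rightarrow>\<^sub>E lcosets H" using x m by (simp add: t Tuple_in_Z_gset_iff)
    then have "(\<lambda>i\<in>{1..m}. \<one> <# t i) = t"
      by (intro ext) (auto simp: lcos_mult_one lcosets_subset[OF H] PiE_iff extensional_def)
    then show ?thesis
      using act_Z_gset[of t m L H id \<one>] x by (simp add: t sym_group_one permutes_id)
  qed
  show "act (Z_gset G m L H) (\<gamma> \<otimes>\<^bsub>G_Sigma G m\<^esub> \<delta>) x =
      act (Z_gset G m L H) \<gamma> (act (Z_gset G m L H) \<delta> x)"
    if \<gamma>: "\<gamma> \<in> carrier (G_Sigma G m)" and \<delta>: "\<delta> \<in> carrier (G_Sigma G m)"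
      and x: "x \<in> pts (Z_gset G m L H)" for \<gamma> \<delta> x
  proof -
    obtain t where t: "x = Tuple t" using x by (rule Z_gset_ptsE)
    obtain g \<sigma> h \<tau> where gs: "\<gamma> = (g, \<sigma>)" "\<delta> = (h, \<tau>)" by (cases \<gamma>, cases \<delta>)
    have g: "g \<in> carrier G" "h \<in> carrier G" and \<sigma>: "\<sigma> permutes {1..m}" and \<tau>: "\<tau> permutes {1..m}"
      using \<gamma> \<delta> by (auto simp: gs sym_group_carrier)
    let ?u = "\<lambda>i\<in>{1..m}. h <# t (inv' \<tau> i)"
    have u: "Tuple ?u \<in> pts (Z_gset G m L H)"
      using closed[OF g(2) \<tau>] act_Z_gset[OF _ \<tau>] x t by metis
    have T: "t i \<subseteq> carrier G" if "i \<in> {1..m}" for i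
      using x that m lcosets_subset[OF H] by (auto simp: t Tuple_in_Z_gset_iff PiE_iff)
    have "(\<lambda>i\<in>{1..m}. g \<otimes> h <# t (inv' (\<sigma> \<circ> \<tau>) i)) = (\<lambda>i\<in>{1..m}. g <# ?u (inv' \<sigma> i))"
    proof (rule restrict_ext)
      fix i assume i: "i \<in> {1..m}"
      then have i': "inv' \<sigma> i \<in> {1..m}" and i'': "inv' \<tau> (inv' \<sigma> i) \<in> {1..m}"
        using permutes_in_image[OF permutes_inv[OF \<sigma>]] permutes_in_image[OF permutes_inv[OF \<tau>]] by blast+
      have "inv' (\<sigma> \<circ> \<tau>) i = inv' \<tau> (inv' \<sigma> i)"
        using permutes_bij[OF \<sigma>] permutes_bij[OF \<tau>] by (simp add: o_inv_distrib)
      then show "g \<otimes> h <# t (inv' (\<sigma> \<circ> \<tau>) i) = g <# ?u (inv' \<sigma> i)"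
        using i' g T[OF i''] by (simp add: lcos_m_assoc)
    qed
    then show ?thesis
      using act_Z_gset[OF x[unfolded t] \<tau>] act_Z_gset[OF u \<sigma>]
        act_Z_gset[OF x[unfolded t] permutes_compose[OF \<tau> \<sigma>]]
      by (simp add: gs t sym_group_mult)
  qed
qed

text \<open>All entries of a tuple lie over the same coset of \<open>L\<close>, so reading the
  projection off the first entry is unaffected by a permutation of the positions.\<close>

lemma gmap_Z_proj:
  assumes fin: "finite (carrier G)" and L: "subgroup L G" and H: "subgroup H G" "H \<subseteq> L" and m: "0 < m"
  shows "gmap (G_Sigma G m) (Z_gset G m L H) (trivial_Sigma (coset_gset G L)) (Z_proj G L)"
proof -
  have one: "1 \<in> {1..m}" using m by simp
  have "H <#> L = L"
    using subgroup.one_closed[OF H(1)] by (intro set_mult_subgroup_absorb[OF L H(2)]) blast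
  then have HL: "(g <# H) <#> L = g <# L" if "g \<in> carrier G" for g
    using that subgroup.subset[OF L] subgroup.subset[OF H(1)] by (simp add: setmult_lcos_assoc)
  have Z: "\<exists>h\<in>carrier G. \<forall>i\<in>{1..m}. t i <#> L = h <# L" if "Tuple t \<in> pts (Z_gset G m L H)" for t
  proof -
    have "t 1 \<in> lcosets H" using that one unfolding Tuple_in_Z_gset_iff[OF m] by blast
    then obtain h where "h \<in> carrier G" "t 1 = h <# H" by (rule lcosetsE)
    then show ?thesis
      using that one HL unfolding Tuple_in_Z_gset_iff[OF m] by metis
  qed
  have "Z_proj G L x \<in> pts (trivial_Sigma (coset_gset G L))"
    if x: "x \<in> pts (Z_gset G m L H)" for x
  proof -
    obtain t where t: "x = Tuple t" using x by (rule Z_gset_ptsE)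
    then obtain h where "h \<in> carrier G" "t 1 <#> L = h <# L"
      using Z x one by blast
    then show ?thesis
      by (simp add: t Z_proj_def trivial_Sigma_def coset_gset_def lcosetsI)
  qed
  moreover have "Z_proj G L (act (Z_gset G m L H) \<gamma> x) =
      act (trivial_Sigma (coset_gset G L)) \<gamma> (Z_proj G L x)"
    if \<gamma>: "\<gamma> \<in> carrier (G_Sigma G m)" and x: "x \<in> pts (Z_gset G m L H)" for \<gamma> x
  proof -
    obtain t where t: "x = Tuple t" using x by (rule Z_gset_ptsE)
    obtain g \<sigma> where gs: "\<gamma> = (g, \<sigma>)" by (cases \<gamma>)
    have g: "g \<in> carrier G" and \<sigma>: "\<sigma> permutes {1..m}"
      using \<gamma> by (auto simp: gs sym_group_carrier)
    obtain h where h: "h \<in> carrier G" "\<And>i. i \<in> {1..m} \<Longrightarrow> t i <#> L = h <# L"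
      using Z[OF x[unfolded t]] by blast
    have i: "inv' \<sigma> 1 \<in> {1..m}"
      using permutes_in_image[OF permutes_inv[OF \<sigma>]] one by blast
    then have sub: "t (inv' \<sigma> 1) \<subseteq> carrier G"
      using x lcosets_subset[OF H(1)] unfolding t Tuple_in_Z_gset_iff[OF m] by blast
    have "Z_proj G L (act (Z_gset G m L H) \<gamma> x) = Coset ((g <# t (inv' \<sigma> 1)) <#> L)"
      using act_Z_gset[OF x[unfolded t] \<sigma>] m by (simp add: Z_proj_def t gs)
    also have "(g <# t (inv' \<sigma> 1)) <#> L = g <# (h <# L)"
      using setmult_lcos_assoc[OF sub subgroup.subset[OF L] g] h(2)[OF i] by simp
    also have "\<dots> = g \<otimes> h <# L"
      using g h subgroup.subset[OF L] by (simp add: lcos_m_assoc)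
    also have "Coset \<dots> = act (trivial_Sigma (coset_gset G L)) \<gamma> (Z_proj G L x)"
      using act_trivial_Sigma_coset_gset[OF L g h(1)] h(2)[OF one] by (simp add: gs t Z_proj_def)
    finally show ?thesis .
  qed
  ultimately show ?thesis
    using finite_Z_gset[OF fin L H(1) m] finite_trivial_Sigma_coset_gset[OF fin L]
    by (auto simp: gmap_def simp del: carrier_DirProd)
qed

text \<open>Reindexing the fixed point equation along \<open>\<sigma>\<close> removes the inverse
  permutation; outside \<open>{1..m}\<close> both sides are \<open>undefined\<close>.\<close>

lemma stabilizer_Z_gset_iff:
  assumes t: "Tuple t \<in> pts (Z_gset G m L H)" and m: "0 < m"
  shows "(g, \<sigma>) \<in> stabilizer (G_Sigma G m) (act (Z_gset G m L H)) (Tuple t) \<longleftrightarrow>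
    g \<in> carrier G \<and> \<sigma> permutes {1..m} \<and> (\<forall>i\<in>{1..m}. t (\<sigma> i) = g <# t i)"
proof -
  have "(\<lambda>i\<in>{1..m}. g <# t (inv' \<sigma> i)) = t \<longleftrightarrow> (\<forall>i\<in>{1..m}. t (\<sigma> i) = g <# t i)"
    if \<sigma>: "\<sigma> permutes {1..m}"
  proof
    assume eq: "(\<lambda>i\<in>{1..m}. g <# t (inv' \<sigma> i)) = t"
    show "\<forall>i\<in>{1..m}. t (\<sigma> i) = g <# t i"
    proof
      fix i assume "i \<in> {1..m}"
      then have "\<sigma> i \<in> {1..m}" using permutes_in_image[OF \<sigma>] by blast
      then show "t (\<sigma> i) = g <# t i"
        using fun_cong[OF eq, of "\<sigma> i"] permutes_inverses(2)[OF \<sigma>] by simp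
    qed
  next
    assume eq: "\<forall>i\<in>{1..m}. t (\<sigma> i) = g <# t i"
    show "(\<lambda>i\<in>{1..m}. g <# t (inv' \<sigma> i)) = t"
    proof
      fix i
      have "t \<in> extensional {1..m}" using t m by (simp add: Tuple_in_Z_gset_iff PiE_iff)
      moreover have "inv' \<sigma> i \<in> {1..m}" if "i \<in> {1..m}"
        using permutes_in_image[OF permutes_inv[OF \<sigma>]] that by blast
      ultimately show "(\<lambda>i\<in>{1..m}. g <# t (inv' \<sigma> i)) i = t i"
        using eq permutes_inverses(1)[OF \<sigma>, of i] unfolding extensional_def
        by (metis (mono_tags, lifting) mem_Collect_eq restrict_apply)
    qed
  qed
  then show ?thesis
    using act_Z_gset[OF t] by (auto simp: stabilizer_def sym_group_carrier)
qed

end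

section \<open>Stabilizers and the two ideals\<close>

lemma (in group) subgroup_graph_subgroup:
  assumes S: "subgroup S G" and a: "a \<in> hom (G\<lparr>carrier := S\<rparr>) (sym_group m)"
  shows "subgroup (graph_subgroup S a) (G_Sigma G m)"
proof -
  interpret S: subgroup S G by fact
  interpret T: group "sym_group m" by (rule sym_group_is_group)
  interpret GS: group "G\<lparr>carrier := S\<rparr>" by (rule S.subgroup_is_group[OF group_axioms])
  interpret a: group_hom "G\<lparr>carrier := S\<rparr>" "sym_group m" a
    using a by unfold_locales
  interpret P: group "G_Sigma G m" by (intro group_G_Sigma group_axioms)
  show ?thesis
  proof (rule P.subgroupI)
    show "graph_subgroup S a \<subseteq> carrier (G_Sigma G m)"
      using a.hom_closed by (auto simp: graph_subgroup_def)
    show "graph_subgroup S a \<noteq> {}"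
      using S.one_closed unfolding graph_subgroup_def by blast
    show "inv\<^bsub>G_Sigma G m\<^esub> x \<in> graph_subgroup S a" if x: "x \<in> graph_subgroup S a" for x
    proof -
      obtain s where s: "s \<in> S" "x = (s, a s)" using x by (auto simp: graph_subgroup_def)
      have "inv\<^bsub>G_Sigma G m\<^esub> x = (inv s, inv\<^bsub>sym_group m\<^esub> a s)"
        unfolding s(2) using s(1) a.hom_closed[of s]
        by (intro inv_DirProd group_axioms T.group_axioms) auto
      also have "inv\<^bsub>sym_group m\<^esub> a s = a (inv s)"
        using a.hom_inv[of s] s(1) m_inv_consistent[OF S s(1)] by simp
      finally show ?thesis using s(1) by (auto simp: graph_subgroup_def)
    qed
    show "x \<otimes>\<^bsub>G_Sigma G m\<^esub> y \<in> graph_subgroup S a"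
      if xy: "x \<in> graph_subgroup S a" "y \<in> graph_subgroup S a" for x y
    proof -
      obtain s u where "s \<in> S" "x = (s, a s)" "u \<in> S" "y = (u, a u)"
        using xy by (auto simp: graph_subgroup_def)
      then show ?thesis
        using a.hom_mult[of s u] by (auto simp: graph_subgroup_def)
    qed
  qed
qed

lemma fst_graph_subgroup: "fst ` graph_subgroup S a = S"
  by (force simp: graph_subgroup_def)

text \<open>Uniqueness of the second component defines \<open>a\<close>, and closure of
  \<open>K\<close> under products makes it multiplicative.\<close>

lemma (in group) functional_subgroup_is_graph:
  assumes K: "subgroup K (G_Sigma G m)"
    and functional: "\<And>g \<sigma> \<tau>. \<lbrakk>(g, \<sigma>) \<in> K; (g, \<tau>) \<in> K\<rbrakk> \<Longrightarrow> \<sigma> = \<tau>"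
  shows "subgroup (fst ` K) G \<and>
    (\<exists>a\<in>hom (G\<lparr>carrier := fst ` K\<rparr>) (sym_group m). K = graph_subgroup (fst ` K) a)"
proof -
  interpret K: subgroup K "G_Sigma G m" by fact
  interpret T: group "sym_group m" by (rule sym_group_is_group)
  define a where "a g = (THE \<sigma>. (g, \<sigma>) \<in> K)" for g
  have a: "a g = \<sigma>" if "(g, \<sigma>) \<in> K" for g \<sigma>
    unfolding a_def using that functional by blast
  have carr: "g \<in> carrier G" "\<sigma> \<in> carrier (sym_group m)" if "(g, \<sigma>) \<in> K" for g \<sigma>
    using K.subset that by auto
  have S: "subgroup (fst ` K) G"
  proof (rule subgroupI)
    show "fst ` K \<subseteq> carrier G" using carr by auto
    show "fst ` K \<noteq> {}" using K.one_closed by auto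
    show "inv s \<in> fst ` K" if s: "s \<in> fst ` K" for s
    proof -
      obtain \<sigma> where \<sigma>: "(s, \<sigma>) \<in> K" using s by auto
      then show ?thesis
        using K.m_inv_closed[OF \<sigma>] inv_DirProd[OF group_axioms T.group_axioms carr[OF \<sigma>]] by force
    qed
    show "s \<otimes> u \<in> fst ` K" if "s \<in> fst ` K" "u \<in> fst ` K" for s u
      using that K.m_closed by (force simp: image_iff)
  qed
  have hom: "a \<in> hom (G\<lparr>carrier := fst ` K\<rparr>) (sym_group m)"
  proof (rule homI)
    show "a s \<in> carrier (sym_group m)" if "s \<in> carrier (G\<lparr>carrier := fst ` K\<rparr>)" for s
      using that a carr by auto
    show "a (s \<otimes>\<^bsub>G\<lparr>carrier := fst ` K\<rparr>\<^esub> u) = a s \<otimes>\<^bsub>sym_group m\<^esub> a u"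
      if su: "s \<in> carrier (G\<lparr>carrier := fst ` K\<rparr>)" "u \<in> carrier (G\<lparr>carrier := fst ` K\<rparr>)" for s u
    proof -
      obtain \<sigma> \<tau> where st: "(s, \<sigma>) \<in> K" "(u, \<tau>) \<in> K" using su by auto
      with a[OF st(1)] a[OF st(2)] a[of "s \<otimes> u" "\<sigma> \<otimes>\<^bsub>sym_group m\<^esub> \<tau>"] K.m_closed[OF st]
      show ?thesis by simp
    qed
  qed
  have "K = graph_subgroup (fst ` K) a"
    using a by (force simp: graph_subgroup_def)
  with S hom show ?thesis by blast
qed

section \<open>Stabilizers of tuples over the base coset\<close>

text \<open>A point over \<open>h <# L\<close> is moved over \<open>L\<close> by the inverse of
  \<open>h\<close>. Such representatives are wanted because their stabilizers project into
  \<open>L\<close> itself rather than into a conjugate.\<close>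

lemma (in group) Z_gset_orbit_over_base:
  assumes L: "subgroup L G" and H: "subgroup H G" "H \<subseteq> L" and fin: "finite (carrier G)" and m: "0 < m"
    and x: "x \<in> pts (Z_gset G m L H)"
  obtains y where "y \<in> orbit (G_Sigma G m) (act (Z_gset G m L H)) x" "Z_proj G L y = Coset L"
proof -
  note gm = gmap_Z_proj[OF fin L H m]
  have "Z_proj G L x \<in> pts (trivial_Sigma (coset_gset G L))"
    using gm x by (auto simp: gmap_def)
  then obtain h where h: "h \<in> carrier G" "Z_proj G L x = Coset (h <# L)"
    by (auto simp: trivial_Sigma_def coset_gset_def elim!: lcosetsE)
  have c: "(inv h, id) \<in> carrier (G_Sigma G m)"
    using h(1) by (simp add: sym_group_carrier permutes_id)
  show ?thesis
  proof (rule that)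
    show "act (Z_gset G m L H) (inv h, id) x \<in> orbit (G_Sigma G m) (act (Z_gset G m L H)) x"
      using c unfolding orbit_def by blast
    have "Z_proj G L (act (Z_gset G m L H) (inv h, id) x) =
        act (trivial_Sigma (coset_gset G L)) (inv h, id) (Z_proj G L x)"
      using gm c x unfolding gmap_def by blast
    also have "\<dots> = Coset L"
      using h act_trivial_Sigma_coset_gset[OF L, of "inv h" h id] subgroup.subset[OF L]
      by (simp add: lcos_mult_one)
    finally show "Z_proj G L (act (Z_gset G m L H) (inv h, id) x) = Coset L" .
  qed
qed

text \<open>By equivariance the stabilizer of \<open>x\<close> fixes the image of \<open>x\<close>,
  and the stabilizer of the coset \<open>L\<close> in \<open>G\<close> is \<open>L\<close>.\<close>

lemma (in group) stabilizer_Z_gset_over_base: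
  assumes L: "subgroup L G" and H: "subgroup H G" "H \<subseteq> L" and fin: "finite (carrier G)" and m: "0 < m"
    and x: "x \<in> pts (Z_gset G m L H)" "Z_proj G L x = Coset L"
    and st: "(g, \<sigma>) \<in> stabilizer (G_Sigma G m) (act (Z_gset G m L H)) x"
  shows "g \<in> L"
proof -
  have c: "(g, \<sigma>) \<in> carrier (G_Sigma G m)" and fixed: "act (Z_gset G m L H) (g, \<sigma>) x = x"
    using st by (auto simp: stabilizer_def)
  have "Z_proj G L (act (Z_gset G m L H) (g, \<sigma>) x) =
      act (trivial_Sigma (coset_gset G L)) (g, \<sigma>) (Z_proj G L x)"
    using gmap_Z_proj[OF fin L H m] c x(1) unfolding gmap_def by blast
  moreover have "Coset L = Coset (\<one> <# L)"
    using subgroup.subset[OF L] by (simp add: lcos_mult_one)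
  ultimately have "Coset L = act (trivial_Sigma (coset_gset G L)) (g, \<sigma>) (Coset (\<one> <# L))"
    using fixed x(2) by simp
  also have "\<dots> = Coset (g <# L)"
    using act_trivial_Sigma_coset_gset[OF L, of g \<one> \<sigma>] c by simp
  finally have "g <# L = L" by simp
  then show ?thesis using l_coset_eq_subgroup_iff[OF L] c by simp
qed

text \<open>The positions reached from 1 form a proper nonempty invariant subset. Moving it to an
  initial segment conjugates the stabilizer into a product with a Young subgroup.\<close>

lemma (in group) intransitive_stabilizer_Z_gset:
  assumes L: "subgroup L G" and H: "subgroup H G" "H \<subseteq> L" and fin: "finite (carrier G)" and m: "0 < m"
    and x: "x \<in> pts (Z_gset G m L H)" "Z_proj G L x = Coset L"
    and k: "k \<in> {1..m}"
      "\<nexists>g \<sigma>. (g, \<sigma>) \<in> stabilizer (G_Sigma G m) (act (Z_gset G m L H)) x \<and> \<sigma> 1 = k"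
  obtains i j y where "i + j = m" "0 < i" "0 < j"
    "y \<in> orbit (G_Sigma G m) (act (Z_gset G m L H)) x" "Z_proj G L y = Coset L"
    "stabilizer (G_Sigma G m) (act (Z_gset G m L H)) y \<subseteq> L \<times> young_subgroup i j"
proof -
  let ?Z = "Z_gset G m L H" and ?P = "G_Sigma G m"
  let ?K = "stabilizer ?P (act ?Z) x"
  interpret P: group ?P by (intro group_G_Sigma group_axioms)
  interpret T: group "sym_group m" by (rule sym_group_is_group)
  have fZ: "finite_gset ?P ?Z" using fin L H(1) m by (rule finite_Z_gset)
  then interpret act: group_action ?P "pts ?Z" "act ?Z" by (simp add: finite_gset_def)
  interpret K: subgroup ?K ?P using x(1) by (rule act.stabilizer_subgroup)
  have perm: "\<sigma> permutes {1..m}" if "(g, \<sigma>) \<in> ?K" for g \<sigma>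
    using K.subset that by (auto simp: sym_group_carrier)
  have one: "1 \<in> {1..m}" using m by simp
  \<comment> \<open>\<open>U\<close> is the orbit of 1 under the permutations occurring in the
    stabilizer. It contains 1 and omits \<open>k\<close>, so both block sizes \<open>card U\<close>
    and \<open>m - card U\<close> are positive.\<close>
  define U where "U = (\<lambda>\<gamma>. snd \<gamma> 1) ` ?K"
  have U: "U \<subseteq> {1..m}"
    using perm one permutes_in_image unfolding U_def by (metis image_subsetI prod.collapse)
  have "k \<notin> U"
  proof
    assume "k \<in> U"
    then obtain g \<sigma> where "(g, \<sigma>) \<in> ?K" "k = \<sigma> 1" unfolding U_def by force
    with k(2) show False by blast
  qed
  then have "U \<subset> {1..m}" using k(1) U by blast
  then have "card U < m"
    using psubset_card_mono[of "{1..m}" U] by simp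
  have "0 < card U"
    using K.one_closed finite_subset[OF U] by (auto simp: U_def card_gt_0_iff)
  have U_inv: "\<sigma> ` U = U" if "(g, \<sigma>) \<in> ?K" for g \<sigma>
  proof -
    \<comment> \<open>The subgroup law gives only this inclusion; injectivity and finiteness turn it
      into an equality.\<close>
    have "\<sigma> ` U \<subseteq> U"
    proof (rule image_subsetI)
      fix i assume "i \<in> U"
      then obtain h \<tau> where h: "(h, \<tau>) \<in> ?K" "i = \<tau> 1" by (auto simp: U_def)
      have "(g \<otimes> h, \<sigma> \<circ> \<tau>) \<in> ?K"
        using K.m_closed[OF that h(1)] by (simp add: sym_group_mult)
      then show "\<sigma> i \<in> U" unfolding U_def h(2) by force
    qed
    moreover have "card (\<sigma> ` U) = card U"
      using card_image[OF inj_on_subset[OF permutes_inj[OF perm[OF that]] subset_UNIV]] .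
    ultimately show ?thesis
      using finite_subset[OF U] by (intro card_subset_eq) auto
  qed
  obtain \<tau> where \<tau>: "\<tau> permutes {1..m}" "\<tau> ` U = {1..card U}"
    using ex_permutes_onto_initial_segment[OF U] by blast
  have c: "(\<one>, \<tau>) \<in> carrier ?P" using \<tau>(1) by (simp add: sym_group_carrier)
  \<comment> \<open>Only positions are moved, so \<open>y\<close> remains over the coset
    \<open>L\<close>.\<close>
  define y where "y = act ?Z (\<one>, \<tau>) x"
  have yZ: "y \<in> pts ?Z" using act_closed[OF fZ c x(1)] by (simp add: y_def)
  have yo: "y \<in> orbit ?P (act ?Z) x" unfolding y_def orbit_def using c by blast
  have "Z_proj G L y = act (trivial_Sigma (coset_gset G L)) (\<one>, \<tau>) (Z_proj G L x)"
    unfolding y_def using gmap_Z_proj[OF fin L H m] c x(1) unfolding gmap_def by blast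
  also have "\<dots> = Coset L"
    using act_trivial_Sigma_coset_gset[OF L, of \<one> \<one> \<tau>] subgroup.subset[OF L]
    by (simp add: x(2) lcos_mult_one)
  finally have yL: "Z_proj G L y = Coset L" .
  have "(g, \<rho>) \<in> L \<times> young_subgroup (card U) (m - card U)"
    if st: "(g, \<rho>) \<in> stabilizer ?P (act ?Z) y" for g \<rho>
  proof -
    have g: "g \<in> L" using stabilizer_Z_gset_over_base[OF L H fin m yZ yL st] .
    have gc: "(g, \<rho>) \<in> carrier ?P" and fixed: "act ?Z (g, \<rho>) y = y"
      using st by (auto simp: stabilizer_def)
    have \<rho>: "\<rho> permutes {1..m}" using gc by (simp add: sym_group_carrier)
    \<comment> \<open>Conjugation by \<open>(\<one>, \<tau>)\<close> carries the stabilizer of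
      \<open>y\<close> back to that of \<open>x\<close>, where invariance of \<open>U\<close> is
      known.\<close>
    let ?c = "inv\<^bsub>?P\<^esub> (\<one>, \<tau>) \<otimes>\<^bsub>?P\<^esub> ((g, \<rho>) \<otimes>\<^bsub>?P\<^esub> (\<one>, \<tau>))"
    have "act ?Z ?c x = act ?Z (inv\<^bsub>?P\<^esub> (\<one>, \<tau>)) (act ?Z (g, \<rho>) y)"
      unfolding y_def
      using act_mult[OF fZ P.inv_closed[OF c] P.m_closed[OF gc c] x(1)] act_mult[OF fZ gc c x(1)]
      by simp
    also have "\<dots> = x"
      unfolding fixed unfolding y_def by (rule act_inv[OF fZ c x(1)])
    finally have "?c \<in> ?K"
      using P.m_closed[OF P.inv_closed[OF c] P.m_closed[OF gc c]] by (simp add: stabilizer_def)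
    moreover have "?c = (g, inv' \<tau> \<circ> (\<rho> \<circ> \<tau>))"
      using gc \<tau>(1) by (simp add: inv_DirProd[OF group_axioms T.group_axioms] sym_group_carrier
          sym_group_mult)
    ultimately have "(inv' \<tau> \<circ> (\<rho> \<circ> \<tau>)) ` U = U" using U_inv by metis
    then have "\<tau> ` (inv' \<tau> \<circ> (\<rho> \<circ> \<tau>)) ` U = \<tau> ` U" by simp
    moreover have "\<tau> \<circ> (inv' \<tau> \<circ> (\<rho> \<circ> \<tau>)) = \<rho> \<circ> \<tau>"
      using permutes_inverses(1)[OF \<tau>(1)] by (simp add: fun_eq_iff)
    ultimately have "\<rho> ` \<tau> ` U = \<tau> ` U" by (metis image_comp)
    then have "\<rho> ` {1..card U} = {1..card U}" by (simp add: \<tau>(2))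
    then show ?thesis
      using g \<rho> \<open>card U < m\<close> by (simp add: young_subgroup_eq)
  qed
  then have "stabilizer ?P (act ?Z) y \<subseteq> L \<times> young_subgroup (card U) (m - card U)"
    by (auto simp: subset_iff)
  with that[of "card U" "m - card U" y] \<open>card U < m\<close> \<open>0 < card U\<close> yo yL show ?thesis by simp
qed

text \<open>Left translation by \<open>g\<close> is injective on cosets, so the permutations in the
  stabilizer preserve equality of entries, and primality makes the entries distinct. The equation
  \<open>t (\<sigma> i) = g <# t i\<close> then determines \<open>\<sigma>\<close> from
  \<open>g\<close>.\<close>

lemma (in group) transitive_stabilizer_Z_gset:
  assumes L: "subgroup L G" and H: "subgroup H G" "H \<subseteq> L" and fin: "finite (carrier G)"
    and p: "Factorial_Ring.prime p"
    and x: "x \<in> pts (Z_gset G p L H)" "Z_proj G L x = Coset L"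
    and trans: "\<And>k. k \<in> {1..p} \<Longrightarrow>
      \<exists>g \<sigma>. (g, \<sigma>) \<in> stabilizer (G_Sigma G p) (act (Z_gset G p L H)) x \<and> \<sigma> 1 = k"
  obtains S a where "subgroup S G" "S \<subseteq> L" "a \<in> hom (G\<lparr>carrier := S\<rparr>) (sym_group p)"
    "contains_long_cycle p (a ` S)"
    "stabilizer (G_Sigma G p) (act (Z_gset G p L H)) x = graph_subgroup S a"
proof -
  let ?Z = "Z_gset G p L H" and ?P = "G_Sigma G p"
  let ?K = "stabilizer ?P (act ?Z) x"
  have p0: "0 < p" using p by (rule prime_gt_0_nat)
  have fZ: "finite_gset ?P ?Z" using fin L H(1) p0 by (rule finite_Z_gset)
  then interpret act: group_action ?P "pts ?Z" "act ?Z" by (simp add: finite_gset_def)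
  have K: "subgroup ?K ?P" using x(1) by (rule act.stabilizer_subgroup)
  obtain t where t: "x = Tuple t" using x(1) by (rule Z_gset_ptsE)
  note stab = stabilizer_Z_gset_iff[OF x(1)[unfolded t] p0, folded t]
  have Z: "t \<in> {1..p} \<rightarrow>\<^sub>E lcosets H" "\<exists>i\<in>{1..p}. \<exists>j\<in>{1..p}. t i \<noteq> t j"
    using x(1) unfolding t Tuple_in_Z_gset_iff[OF p0] by blast+
  have sub: "t i \<subseteq> carrier G" if "i \<in> {1..p}" for i
    using lcosets_subset[OF H(1)] PiE_mem[OF Z(1) that] .
  have inj: "inj_on t {1..p}"
  proof (rule fibres_of_transitive_invariant_map[OF p _ Z(2)])
    fix i assume "i \<in> {1..p}"
    then obtain g \<sigma> where g: "(g, \<sigma>) \<in> ?K" "\<sigma> 1 = i" using trans by blast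
    have "t (\<sigma> j) = t (\<sigma> k) \<longleftrightarrow> t j = t k" if "j \<in> {1..p}" "k \<in> {1..p}" for j k
      using g(1) that l_coset_inj[of g "t j" "t k"] sub unfolding stab by metis
    with g show "\<exists>\<sigma>. \<sigma> permutes {1..p} \<and> \<sigma> 1 = i \<and>
        (\<forall>j\<in>{1..p}. \<forall>k\<in>{1..p}. t (\<sigma> j) = t (\<sigma> k) \<longleftrightarrow> t j = t k)"
      unfolding stab by blast
  qed
  have functional: "\<sigma> = \<tau>" if "(g, \<sigma>) \<in> ?K" "(g, \<tau>) \<in> ?K" for g \<sigma> \<tau>
  proof
    fix i
    have st: "\<sigma> permutes {1..p}" "\<tau> permutes {1..p}"
      "\<And>i. i \<in> {1..p} \<Longrightarrow> t (\<sigma> i) = t (\<tau> i)"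
      using that unfolding stab by auto
    show "\<sigma> i = \<tau> i"
    proof (cases "i \<in> {1..p}")
      case True
      then show ?thesis
        using inj_onD[OF inj st(3)[OF True]] permutes_in_image[OF st(1)] permutes_in_image[OF st(2)]
        by blast
    next
      case False
      then show ?thesis using st(1,2) by (metis permutes_not_in)
    qed
  qed
  obtain a where S: "subgroup (fst ` ?K) G" and a: "a \<in> hom (G\<lparr>carrier := fst ` ?K\<rparr>) (sym_group p)"
    and graph: "?K = graph_subgroup (fst ` ?K) a"
    using functional_subgroup_is_graph[OF K] functional by blast
  have SL: "fst ` ?K \<subseteq> L"
    using stabilizer_Z_gset_over_base[OF L H fin p0 x] by auto
  interpret a: group_hom "G\<lparr>carrier := fst ` ?K\<rparr>" "sym_group p" a
    using a sym_group_is_group subgroup.subgroup_is_group[OF S group_axioms]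
    by (simp add: group_hom_def group_hom_axioms_def)
  have "subgroup (a ` fst ` ?K) (sym_group p)"
    using a.img_is_subgroup by simp
  moreover have "\<exists>\<sigma>\<in>a ` fst ` ?K. \<sigma> 1 = i" if i: "i \<in> {1..p}" for i
  proof -
    obtain g \<sigma> where "(g, \<sigma>) \<in> ?K" "\<sigma> 1 = i" using trans[OF i] by blast
    moreover from this have "g \<in> fst ` ?K" "\<sigma> = a g"
      using graph by (force, force simp: graph_subgroup_def)
    ultimately show ?thesis by blast
  qed
  ultimately have "contains_long_cycle p (a ` fst ` ?K)"
    using p by (intro transitive_contains_long_cycle) auto
  with S SL a graph that show ?thesis by blast
qed

section \<open>A tuple fixed by a given graph\<close>

text \<open>Through \<open>a\<close> the group \<open>S\<close> acts transitively on
  \<open>{1..p}\<close>. The tuple is the orbit-stabilizer bijection from positions to cosets of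
  \<open>H\<close>, and its equivariance says that the graph fixes it.\<close>

lemma (in group) graph_stabilizes_tuple:
  assumes L: "subgroup L G" and fin: "finite (carrier G)" and p: "Factorial_Ring.prime p"
    and S: "subgroup S G" "S \<subseteq> L" and a: "a \<in> hom (G\<lparr>carrier := S\<rparr>) (sym_group p)"
    and cyc: "contains_long_cycle p (a ` S)"
  obtains H x where "subgroup H G" "H \<subseteq> L" "x \<in> pts (Z_gset G p L H)" "Z_proj G L x = Coset L"
    "graph_subgroup S a \<subseteq> stabilizer (G_Sigma G p) (act (Z_gset G p L H)) x"
proof -
  interpret S: subgroup S G by fact
  interpret a: group_hom "G\<lparr>carrier := S\<rparr>" "sym_group p" a
    using a sym_group_is_group S.subgroup_is_group[OF group_axioms]
    by (simp add: group_hom_def group_hom_axioms_def)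
  have p0: "0 < p" using p by (rule prime_gt_0_nat)
  have one: "1 \<in> {1..p}" and two: "2 \<in> {1..p}"
    using prime_ge_2_nat[OF p] by auto
  have perm: "a s permutes {1..p}" if "s \<in> S" for s
    using a.hom_closed[of s] that by (simp add: sym_group_carrier)
  have a_mult: "a (s \<otimes> u) = a s \<circ> a u" if "s \<in> S" "u \<in> S" for s u
    using a.hom_mult[of s u] that by (simp add: sym_group_mult)
  have a_inv: "a (inv s) = inv' (a s)" if "s \<in> S" for s
    using a.hom_inv[of s] that m_inv_consistent[OF S(1) that] perm[OF that]
    by (simp add: sym_group_carrier)
  define H where "H = {s \<in> S. a s 1 = 1}"
  have H: "subgroup H G"
  proof (rule subgroupI)
    show "H \<subseteq> carrier G" by (auto simp: H_def)
    have "\<one> \<in> H" using a.hom_one by (simp add: H_def sym_group_one)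
    then show "H \<noteq> {}" by blast
    show "inv s \<in> H" if "s \<in> H" for s
      using that a_inv permutes_inv_eq[OF perm] by (auto simp: H_def)
    show "s \<otimes> u \<in> H" if "s \<in> H" "u \<in> H" for s u
      using that by (auto simp: H_def a_mult)
  qed
  have coset_eq: "s <# H = u <# H \<longleftrightarrow> a s 1 = a u 1" if "s \<in> S" "u \<in> S" for s u
  proof -
    have "s <# H = u <# H \<longleftrightarrow> inv u \<otimes> s \<in> H"
      using that by (intro l_coset_eq_iff[OF H]) auto
    also have "\<dots> \<longleftrightarrow> inv' (a u) (a s 1) = 1"
      using that by (simp add: H_def a_mult a_inv)
    also have "\<dots> \<longleftrightarrow> a s 1 = a u 1"
      using permutes_inv_eq[OF perm[OF that(2)]] by metis
    finally show ?thesis .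
  qed
  have "\<exists>s\<in>S. a s 1 = i" if "i \<in> {1..p}" for i
    using long_cycle_transitive[OF _ cyc one that] a.img_is_subgroup by auto
  then obtain r where r: "\<And>i. i \<in> {1..p} \<Longrightarrow> r i \<in> S" "\<And>i. i \<in> {1..p} \<Longrightarrow> a (r i) 1 = i"
    by metis
  have HL: "H \<subseteq> L" using S(2) by (auto simp: H_def)
  have H1: "\<one> \<in> H" using H by (rule subgroup.one_closed)
  define t where "t = (\<lambda>i\<in>{1..p}. r i <# H)"
  have tL: "t i <#> L = L" if "i \<in> {1..p}" for i
  proof (rule set_mult_subgroup_absorb[OF L])
    have "r i \<in> L" using r(1)[OF that] S(2) by blast
    then show "t i \<subseteq> L"
      using that HL subgroup.m_closed[OF L] by (auto simp: t_def l_coset_def)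
    show "t i \<noteq> {}" using that H1 by (auto simp: t_def l_coset_def)
  qed
  have tZ: "Tuple t \<in> pts (Z_gset G p L H)"
    unfolding Tuple_in_Z_gset_iff[OF p0]
  proof (intro conjI)
    show "t \<in> {1..p} \<rightarrow>\<^sub>E lcosets H"
      using r(1) by (auto simp: t_def intro!: lcosetsI)
    show "\<forall>i\<in>{1..p}. \<forall>j\<in>{1..p}. t i <#> L = t j <#> L" using tL by simp
    \<comment> \<open>Since \<open>p\<close> is at least 2, the positions 1 and 2 exist, and they
      carry different cosets; this keeps the tuple off the diagonal.\<close>
    have "t 1 \<noteq> t 2"
      using coset_eq[OF r(1)[OF one] r(1)[OF two]] r(2)[OF one] r(2)[OF two] one two
      by (simp add: t_def del: atLeastAtMost_iff)
    then show "\<exists>i\<in>{1..p}. \<exists>j\<in>{1..p}. t i \<noteq> t j" using one two by blast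
  qed
  have stab: "(s, a s) \<in> stabilizer (G_Sigma G p) (act (Z_gset G p L H)) (Tuple t)" if s: "s \<in> S" for s
    unfolding stabilizer_Z_gset_iff[OF tZ p0]
  proof (intro conjI ballI)
    show "s \<in> carrier G" using s by simp
    show "a s permutes {1..p}" using s by (rule perm)
    fix i assume i: "i \<in> {1..p}"
    then have ai: "a s i \<in> {1..p}" using permutes_in_image[OF perm[OF s]] by blast
    \<comment> \<open>Under \<open>a\<close>, both \<open>r (a s i)\<close> and
      \<open>s \<otimes> r i\<close> take 1 to \<open>a s i\<close>, hence they represent the same
      coset.\<close>
    have "r (a s i) <# H = s \<otimes> r i <# H"
      using r(1)[OF ai] r(2)[OF ai] r(1)[OF i] r(2)[OF i] s by (simp add: coset_eq a_mult)
    also have "\<dots> = s <# (r i <# H)"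
      using s r(1)[OF i] subgroup.subset[OF H] by (simp add: lcos_m_assoc)
    finally show "t (a s i) = s <# t i"
      using i ai by (simp add: t_def del: atLeastAtMost_iff)
  qed
  show ?thesis
  proof (rule that[OF H HL tZ])
    show "Z_proj G L (Tuple t) = Coset L" using tL[OF one] by (simp add: Z_proj_def)
    show "graph_subgroup S a \<subseteq> stabilizer (G_Sigma G p) (act (Z_gset G p L H)) (Tuple t)"
      using stab by (auto simp: graph_subgroup_def)
  qed
qed

section \<open>Transfers from Young subgroups\<close>

text \<open>A single transfer is the sum whose family is zero at all other pairs.\<close>

lemma tr_image_subset_I_Tr:
  assumes G: "group G" "finite (carrier G)" and R: "green_functor (G_Sigma G m) R res tr"
    and L: "subgroup L G" and ij: "i + j = m" "0 < i" "0 < j"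
  shows "tr (prod_coset_gset G m (L \<times> young_subgroup i j)) (trivial_Sigma (coset_gset G L))
    (coset_proj G L) ` carrier (R (prod_coset_gset G m (L \<times> young_subgroup i j))) \<subseteq> I_Tr G m R tr L"
proof (rule image_subsetI)
  interpret green_functor "G_Sigma G m" R res tr by fact
  interpret G: group G by fact
  let ?K = "\<lambda>(i, j). L \<times> young_subgroup i j"
  let ?A = "\<lambda>ij. prod_coset_gset G m (?K ij)" and ?B = "trivial_Sigma (coset_gset G L)"
  let ?I = "{(i, j). i + j = m \<and> 0 < i \<and> 0 < j}"
  interpret B: abelian_group "R ?B"
    by (intro abelian_group G.finite_trivial_Sigma_coset_gset G L)
  have K: "subgroup (?K q) (G_Sigma G m)" if "q \<in> ?I" for q
    using that DirProd_subgroups[OF G(1) L sym_group_is_group subgroup_young_subgroup] by auto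
  have gm: "gmap (G_Sigma G m) (?A q) ?B (coset_proj G L)" if "q \<in> ?I" for q
    using that by (intro G.gmap_coset_proj G L K) (auto split: prod.splits)
  fix z assume z: "z \<in> carrier (R (prod_coset_gset G m (L \<times> young_subgroup i j)))"
  define x where "x q = (if q = (i, j) then z else \<zero>\<^bsub>R (?A q)\<^esub>)" for q
  have x: "x q \<in> carrier (R (?A q))" if "q \<in> ?I" for q
  proof -
    interpret A: abelian_group "R (?A q)"
      using gm[OF that] by (intro abelian_group) (simp add: gmap_def)
    show ?thesis using z by (simp add: x_def)
  qed
  have fin: "finite ?I"
    by (rule finite_subset[of _ "{..m} \<times> {..m}"]) auto
  let ?f = "\<lambda>q. tr (?A q) ?B (coset_proj G L) (x q)"
  have f0: "?f q = \<zero>\<^bsub>R ?B\<^esub>" if "q \<in> ?I" "q \<noteq> (i, j)" for q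
    using abelian_group_hom.hom_zero[OF tr_hom[OF gm[OF that(1)]]] that(2) by (simp add: x_def)
  have fz: "?f (i, j) = tr (prod_coset_gset G m (L \<times> young_subgroup i j)) ?B (coset_proj G L) z"
    by (simp add: x_def)
  have mem: "(i, j) \<in> ?I" using ij by simp
  have closed: "?f q \<in> carrier (R ?B)" if "q \<in> ?I" for q
    using tr_closed[OF gm[OF that] x[OF that]] .
  have "finsum (R ?B) ?f ?I = finsum (R ?B) (\<lambda>q. if (i, j) = q then ?f q else \<zero>\<^bsub>R ?B\<^esub>) ?I"
    using closed f0 by (intro B.finsum_cong') auto
  also have "\<dots> = ?f (i, j)"
    using closed by (intro B.finsum_singleton[OF mem fin]) auto
  finally have "tr (prod_coset_gset G m (L \<times> young_subgroup i j)) ?B (coset_proj G L) z =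
      finsum (R ?B) ?f ?I" using fz by simp
  moreover have "?f = (\<lambda>(i, j). tr (prod_coset_gset G m (L \<times> young_subgroup i j)) ?B (coset_proj G L) (x (i, j)))"
    by (auto simp: fun_eq_iff)
  moreover have "\<forall>i j. i + j = m \<and> 0 < i \<and> 0 < j \<longrightarrow>
      x (i, j) \<in> carrier (R (prod_coset_gset G m (L \<times> young_subgroup i j)))"
    using x by auto
  ultimately show "tr (prod_coset_gset G m (L \<times> young_subgroup i j)) ?B (coset_proj G L) z
      \<in> I_Tr G m R tr L"
    unfolding I_Tr_def induced_green_def by auto
qed

text \<open>Needed for the use of \<open>genideal_ideal\<close> and \<open>genideal_self\<close>,
  which ask the generators to lie in the carrier.\<close>

lemma I_Tr_subset_carrier:
  assumes G: "group G" "finite (carrier G)" and R: "green_functor (G_Sigma G m) R res tr"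
    and L: "subgroup L G"
  shows "I_Tr G m R tr L \<subseteq> carrier (induced_green R (coset_gset G L))"
proof -
  interpret green_functor "G_Sigma G m" R res tr by fact
  interpret G: group G by fact
  let ?B = "trivial_Sigma (coset_gset G L)"
  interpret B: abelian_group "R ?B"
    by (intro abelian_group G.finite_trivial_Sigma_coset_gset G L)
  have "subgroup (L \<times> young_subgroup i j) (G_Sigma G m)" if "i + j = m" for i j
    using that DirProd_subgroups[OF G(1) L sym_group_is_group subgroup_young_subgroup] by auto
  then have gm: "gmap (G_Sigma G m) (prod_coset_gset G m (L \<times> young_subgroup i j)) ?B (coset_proj G L)"
    if "i + j = m" for i j
    using that by (intro G.gmap_coset_proj G L) auto
  have "finsum (R ?B) (\<lambda>(i, j). tr (prod_coset_gset G m (L \<times> young_subgroup i j)) ?B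
      (coset_proj G L) (x (i, j))) {(i, j). i + j = m \<and> 0 < i \<and> 0 < j} \<in> carrier (R ?B)"
    if x: "\<forall>i j. i + j = m \<and> 0 < i \<and> 0 < j \<longrightarrow>
      x (i, j) \<in> carrier (R (prod_coset_gset G m (L \<times> young_subgroup i j)))" for x
  proof (rule B.finsum_closed, rule Pi_I)
    fix q assume "q \<in> {(i, j). i + j = m \<and> 0 < i \<and> 0 < j}"
    then obtain i j where q: "q = (i, j)" and ij: "i + j = m" "0 < i" "0 < j" by blast
    show "(case q of (i, j) \<Rightarrow> tr (prod_coset_gset G m (L \<times> young_subgroup i j)) ?B
        (coset_proj G L) (x (i, j))) \<in> carrier (R ?B)"
      using tr_closed[OF gm[OF ij(1)]] x ij by (simp add: q)
  qed
  then show ?thesis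
    unfolding I_Tr_def induced_green_def by blast
qed

section \<open>Comparison of the two generated ideals\<close>

theorem proposition3p22:
  fixes G :: "('g, 'b) monoid_scheme"
    and p :: nat
    and R :: "('g \<times> (nat \<Rightarrow> nat), 'g point) gset \<Rightarrow> 'r ring"
    and res tr :: "('g \<times> (nat \<Rightarrow> nat), 'g point) gset \<Rightarrow> ('g \<times> (nat \<Rightarrow> nat), 'g point) gset
      \<Rightarrow> ('g point \<Rightarrow> 'g point) \<Rightarrow> 'r \<Rightarrow> 'r"
    and L :: "'g set"
  assumes "group G" and "finite (carrier G)"
    and "Factorial_Ring.prime p"
    and "green_functor (G \<times>\<times> sym_group p) R res tr"
    and "subgroup L G"
  shows "J_ideal G p R tr L =
    Idl\<^bsub>induced_green R (coset_gset G L)\<^esub>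
      (I_Tr G p R tr L \<union>
       (\<Union>(S, a)\<in>{(S, a). subgroup S G \<and> S \<subseteq> L \<and> a \<in> hom (G\<lparr>carrier := S\<rparr>) (sym_group p) \<and>
                     contains_long_cycle p (a ` S)}.
          tr (prod_coset_gset G p (graph_subgroup S a)) (trivial_Sigma (coset_gset G L))
             (coset_proj G L)
           ` carrier (R (prod_coset_gset G p (graph_subgroup S a)))))"
proof -
  interpret G: group G by fact
  interpret green_functor "G_Sigma G p" R res tr by fact
  note fin = assms(2) and p = assms(3) and L = assms(5)
  have p0: "0 < p" using p by (rule prime_gt_0_nat)
  let ?P = "G_Sigma G p"
  let ?B = "trivial_Sigma (coset_gset G L)"
  let ?R = "induced_green R (coset_gset G L)"
  let ?graphs = "{(S, a). subgroup S G \<and> S \<subseteq> L \<and> a \<in> hom (G\<lparr>carrier := S\<rparr>) (sym_group p) \<and>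
    contains_long_cycle p (a ` S)}"
  let ?trZ = "\<lambda>H. tr (Z_gset G p L H) ?B (Z_proj G L) ` carrier (R (Z_gset G p L H))"
  let ?trg = "\<lambda>(S, a). tr (prod_coset_gset G p (graph_subgroup S a)) ?B (coset_proj G L)
    ` carrier (R (prod_coset_gset G p (graph_subgroup S a)))"
  let ?Z = "\<Union>H\<in>{H. subgroup H G \<and> H \<subseteq> L}. ?trZ H" and ?g = "\<Union>q\<in>?graphs. ?trg q"
  interpret R: cring ?R
    unfolding induced_green_def by (intro cring G.finite_trivial_Sigma_coset_gset fin L)
  have gZ: "gmap ?P (Z_gset G p L H) ?B (Z_proj G L)" if "subgroup H G" "H \<subseteq> L" for H
    using that by (intro G.gmap_Z_proj fin L p0)
  have sg: "subgroup (graph_subgroup S a) ?P" "fst ` graph_subgroup S a \<subseteq> L"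
    if "(S, a) \<in> ?graphs" for S a
    using that by (auto intro: G.subgroup_graph_subgroup simp: fst_graph_subgroup)
  have gg: "gmap ?P (prod_coset_gset G p (graph_subgroup S a)) ?B (coset_proj G L)"
    if "(S, a) \<in> ?graphs" for S a
    by (intro G.gmap_coset_proj fin sg[OF that] L)
  have carI: "I_Tr G p R tr L \<subseteq> carrier ?R"
    using I_Tr_subset_carrier[OF assms(1,2,4,5)] .
  have carZ: "?Z \<subseteq> carrier ?R"
    using gZ by (auto simp: induced_green_def intro!: tr_closed)
  have carg: "?g \<subseteq> carrier ?R"
    using gg by (auto simp: induced_green_def intro!: tr_closed)
  let ?IZ = "Idl\<^bsub>?R\<^esub> (I_Tr G p R tr L \<union> ?Z)" and ?Ig = "Idl\<^bsub>?R\<^esub> (I_Tr G p R tr L \<union> ?g)"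
  have idZ: "ideal ?IZ ?R" and idg: "ideal ?Ig ?R"
    by (intro R.genideal_ideal Un_least carI carZ carg)+
  have subZ: "I_Tr G p R tr L \<union> ?Z \<subseteq> ?IZ" and subg: "I_Tr G p R tr L \<union> ?g \<subseteq> ?Ig"
    by (intro R.genideal_self Un_least carI carZ carg)+
  have subI: "I_Tr G p R tr L \<subseteq> ?IZ" "I_Tr G p R tr L \<subseteq> ?Ig"
    using subZ subg by (simp_all only: Un_subset_iff)
  have trZ_sub: "?trZ H \<subseteq> ?IZ" if "subgroup H G" "H \<subseteq> L" for H
    by (rule subset_trans[OF _ subZ], rule le_supI2, rule UN_upper) (use that in simp)
  have trg_sub: "?trg q \<subseteq> ?Ig" if "q \<in> ?graphs" for q
    by (rule subset_trans[OF _ subg], rule le_supI2, rule UN_upper) (rule that)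
  \<comment> \<open>Transfers from graphs: the tuple fixed by the graph makes the transfer factor
    through a set \<open>Z_gset G p L H\<close>.\<close>
  have "?trg (S, a) \<subseteq> ?IZ" if Sa: "(S, a) \<in> ?graphs" for S a
  proof -
    from Sa have S: "subgroup S G" "S \<subseteq> L" "a \<in> hom (G\<lparr>carrier := S\<rparr>) (sym_group p)"
      "contains_long_cycle p (a ` S)" by auto
    obtain H x where H: "subgroup H G" "H \<subseteq> L"
      and x: "x \<in> pts (Z_gset G p L H)" "Z_proj G L x = Coset L"
      and stab: "graph_subgroup S a \<subseteq> stabilizer ?P (act (Z_gset G p L H)) x"
      using G.graph_stabilizes_tuple[OF L fin p S] .
    have "?trg (S, a) \<subseteq> ?trZ H"
      unfolding prod.case
      by (rule tr_image_subset_of_stabilizer[OF gg[OF Sa]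
            G.base_point_prod_coset_gset[OF fin sg(1)[OF Sa]]
            G.orbit_prod_coset_gset[OF fin sg(1)[OF Sa]] gZ[OF H] x(1)])
        (use x(2) stab G.coset_proj_base_point[OF sg(1)[OF Sa] L sg(2)[OF Sa]]
          G.stabilizer_prod_coset_gset[OF fin sg(1)[OF Sa]] in simp_all)
    then show ?thesis using trZ_sub[OF H] by (rule subset_trans)
  qed
  then have "?trg q \<subseteq> ?IZ" if "q \<in> ?graphs" for q
    using that by (cases q) (simp only:)
  then have "?g \<subseteq> ?IZ" by (rule UN_least)
  \<comment> \<open>Conversely, an ideal is closed under sums, so the orbits of
    \<open>Z_gset G p L H\<close> can be treated one at a time.\<close>
  moreover have "?trZ H \<subseteq> ?Ig" if H: "subgroup H G" "H \<subseteq> L" for H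
  proof (rule tr_image_subset_orbitwise[OF gZ[OF H]])
    let ?Z = "Z_gset G p L H"
    interpret I: ideal ?Ig ?R by (rule idg)
    show "\<zero>\<^bsub>R ?B\<^esub> \<in> ?Ig" using I.zero_closed by (simp add: induced_green_def)
    show "u \<oplus>\<^bsub>R ?B\<^esub> v \<in> ?Ig" if "u \<in> ?Ig" "v \<in> ?Ig" for u v
      using I.a_closed[OF that] by (simp add: induced_green_def)
    fix x0 assume x0: "x0 \<in> pts ?Z"
    have fZ: "finite_gset ?P ?Z" using fin L H(1) p0 by (rule G.finite_Z_gset)
    obtain x where x: "x \<in> orbit ?P (act ?Z) x0" "Z_proj G L x = Coset L"
      using G.Z_gset_orbit_over_base[OF L H fin p0 x0] .
    have xZ: "x \<in> pts ?Z" using orbit_subset_pts[OF fZ x0] x(1) by blast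
    let ?O = "sub_gset ?Z (orbit ?P (act ?Z) x0)"
    have gO: "gmap ?P ?O ?B (Z_proj G L)"
      by (intro gmap_sub_gset gZ H invariant_orbit fZ x0)
    have orbit_x: "orbit ?P (act ?Z) x = orbit ?P (act ?Z) x0"
      using orbit_eq[OF fZ x0 x(1)] .
    \<comment> \<open>Both cases below use this factorization, with different representatives
      \<open>y\<close> of the orbit and different subgroups \<open>K\<close> above the stabilizer of
      \<open>y\<close>.\<close>
    have factor: "tr ?O ?B (Z_proj G L) ` carrier (R ?O) \<subseteq>
        tr (prod_coset_gset G p K) ?B (coset_proj G L) ` carrier (R (prod_coset_gset G p K))"
      if y: "y \<in> orbit ?P (act ?Z) x" "Z_proj G L y = Coset L"
        and K: "subgroup K ?P" "fst ` K \<subseteq> L" and stab: "stabilizer ?P (act ?Z) y \<subseteq> K" for y K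
    proof (rule tr_image_subset_of_stabilizer[OF gO _ _ G.gmap_coset_proj[OF fin K(1) L K(2)]
            G.base_point_prod_coset_gset[OF fin K(1)]])
      have y0: "y \<in> orbit ?P (act ?Z) x0" using y(1) orbit_x by simp
      then show "y \<in> pts ?O" by simp
      have "orbit ?P (act ?O) y = orbit ?P (act ?Z) y"
        using y0 by (simp add: orbit_def)
      then show "pts ?O = orbit ?P (act ?O) y"
        using orbit_eq[OF fZ x0 y0] by simp
      show "coset_proj G L (ProdCoset K) = Z_proj G L y"
        using G.coset_proj_base_point[OF K(1) L K(2)] y(2) by simp
      show "stabilizer ?P (act ?O) y \<subseteq> stabilizer ?P (act (prod_coset_gset G p K)) (ProdCoset K)"
        using stab y0 unfolding G.stabilizer_prod_coset_gset[OF fin K(1)] by (simp add: stabilizer_def)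
    qed
    show "tr ?O ?B (Z_proj G L) ` carrier (R ?O) \<subseteq> ?Ig"
    \<comment> \<open>Whether the permutations occurring in the stabilizer act transitively is
      tested on the orbit of 1. Transitivity leads to a graph, its failure to a Young
      subgroup.\<close>
    proof (cases "\<forall>k\<in>{1..p}. \<exists>g \<sigma>. (g, \<sigma>) \<in> stabilizer ?P (act ?Z) x \<and> \<sigma> 1 = k")
      case True
      obtain S a where "subgroup S G" "S \<subseteq> L" "a \<in> hom (G\<lparr>carrier := S\<rparr>) (sym_group p)"
        "contains_long_cycle p (a ` S)" and stab: "stabilizer ?P (act ?Z) x = graph_subgroup S a"
        using G.transitive_stabilizer_Z_gset[OF L H fin p xZ x(2)] True by blast
      then have Sa: "(S, a) \<in> ?graphs" by simp
      have "tr ?O ?B (Z_proj G L) ` carrier (R ?O) \<subseteq> ?trg (S, a)"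
        unfolding prod.case
        using factor[OF orbit_self[OF fZ xZ] x(2) sg[OF Sa]] stab by simp
      then show ?thesis using trg_sub[OF Sa] by (rule subset_trans)
    next
      case False
      then obtain k where k: "k \<in> {1..p}"
        "\<nexists>g \<sigma>. (g, \<sigma>) \<in> stabilizer ?P (act ?Z) x \<and> \<sigma> 1 = k"
        by blast
      obtain i j y where ij: "i + j = p" "0 < i" "0 < j"
        and y: "y \<in> orbit ?P (act ?Z) x" "Z_proj G L y = Coset L"
        and stab: "stabilizer ?P (act ?Z) y \<subseteq> L \<times> young_subgroup i j"
        using G.intransitive_stabilizer_Z_gset[OF L H fin p0 xZ x(2) k] .
      have "subgroup (L \<times> young_subgroup i j) ?P"
        using DirProd_subgroups[OF assms(1) L sym_group_is_group subgroup_young_subgroup] ij(1) by auto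
      then have "tr ?O ?B (Z_proj G L) ` carrier (R ?O) \<subseteq> I_Tr G p R tr L"
        by (intro subset_trans[OF factor[OF y _ _ stab] tr_image_subset_I_Tr[OF assms(1,2,4,5) ij]])
          auto
      then show ?thesis using subI(2) by (rule subset_trans)
    qed
  qed
  then have "?Z \<subseteq> ?Ig" by (intro UN_least) simp
  \<comment> \<open>Each ideal contains the generators of the other, so minimality gives both
    inclusions.\<close>
  ultimately have "?IZ = ?Ig"
    by (intro subset_antisym R.genideal_minimal[OF idg] R.genideal_minimal[OF idZ] Un_least subI)
  then show ?thesis
    unfolding J_ideal_def .
qed

end
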